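(* Let $\lambda_{PH},\lambda_w,\beta,\kappa,R_D>0$, $K\in(0,1)$ and $N_{max}\in\{0,1,2,\dots\}\cup\{\infty\}$. For $N\in\{0,\dots,N_{max}\}$ let $\Psi_N$ be the independent Poisson point processes on the disc of radius $R_D$ described in the context, and let $$L^{(0)}=\min_{N}\Big\{\min_{n\in\Psi_N}\{l_N(r^{(n)})\}\Big\},\qquad l_N(r)=\frac{\kappa r^\beta}{K^N},$$ where $r^{(n)}$ is the distance of the point $n$ from the origin. For real $\eta\ge 0$ define $$\chi_\eta(\lambda_w)=\lambda_w^\eta\left[\frac{2^{\frac{\eta}{2}}\sqrt{\pi}\,\Gamma\left(\frac{\eta+1}{2}\right)}{\Gamma\left(\frac{\eta+2}{2}\right)}-\frac{\sqrt{2}\;{}_2F_1\left(\frac12,\frac{\eta+1}{2};\frac{\eta+3}{2};\frac12\right)}{\eta+1}\right].$$ Then, for every $\alpha>0$, the cumulative distribution function of $L^{(0)}$ is $$F_{L^{(0)}}(\alpha)=\Pr\{L^{(0)}\le\alpha\}=1-\prod_{N=0}^{N_{max}}\exp\{-\Lambda_N([0,\alpha))\},$$ where $$\Lambda_N([0,\alpha))=\begin{cases}\displaystyle\frac{4\lambda_{PH}}{N!}\sum_{\eta=N}^{\infty}\frac{(-1)^{\eta-N}\chi_\eta(\lambda_w)}{(\eta-N)!\,(\eta+2)}\left(\frac{\alpha K^N}{\kappa}\right)^{\frac{\eta+2}{\beta}} & \text{if }\alpha<\dfrac{R_D^\beta\kappa}{K^N},\\[3ex] \displaystyle\frac{4\lambda_{PH}}{N!}\sum_{\eta=N}^{\infty}\frac{(-1)^{\eta-N}\chi_\eta(\lambda_w)}{(\eta-N)!\,(\eta+2)}R_D^{\eta+2}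 & \text{if }\alpha\ge\dfrac{R_D^\beta\kappa}{K^N}\end{cases}$$ (the sums are over integers $\eta$) is the intensity of the point process $L_N=\{l_N(r^{(n)}),\,n\in\Psi_N\}$, i.e. $\Lambda_N([0,\alpha))$ is the expected number of points of $L_N$ in $[0,\alpha)$.
   Context: Model. Transmitters ("power heads", PHs) are located in the disc of radius $R_D$ centred at the origin of $\mathbb{R}^2$; the receiver is at the origin. The transmitters whose signal crosses exactly $N$ walls on the way to the receiver form a Poisson point process $\Psi_N$ on this disc; the processes $\Psi_N$, $N\in\{0,\dots,N_{max}\}$, are assumed mutually independent (all $N\ge 0$ if $N_{max}=\infty$). In polar coordinates $(r,\theta)$, $\Psi_N$ has density with respect to area measure $r\,dr\,d\theta$ equal to $$\lambda_N(r,\theta)=\lambda_{PH}P_N(r,\theta),\qquad P_N(r,\theta)=\frac{(\lambda_w r|\cos\theta|+\lambda_w r|\sin\theta|)^N}{N!}\exp\{-(\lambda_w r|\cos\theta|+\lambda_w r|\sin\theta|)\}.$$ Here $N_{max}$ is the maximum number of walls that can be encountered in the disc, $\lambda_w$ is the frequency of walls, $K$ the penetration loss per wall, $\beta$ the path-loss exponent and $\kappa$ the path-loss constant. Convention: the minimum over an empty set of points is $+\infty$. ${}_2F_1$ is the Gaussian hypergeometric function and $\Gamma(\cdot)$ the Gamma function. *)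

theory Defs
  imports "HOL-Probability.Probability" "HOL-Analysis.Analysis"
begin

section \<open>Finite point processes\<close>

text \<open>
  A configuration of finitely many points, possibly with multiplicities, is a multiset. This covers
  every locally finite point process on a bounded region.
\<close>

definition count_in :: "'a set \<Rightarrow> 'a multiset \<Rightarrow> nat" where
  "count_in B X = size (filter_mset (\<lambda>x. x \<in> B) X)"

text \<open>Configurations in the space of \<open>S\<close>, with the \<open>\<sigma>\<close>-algebra generated by the counting maps.\<close>

definition configurations :: "'a measure \<Rightarrow> 'a multiset measure" where
  "configurations S =
     sigma {X. set_mset X \<subseteq> space S}
           {{X. set_mset X \<subseteq> space S \<and> count_in B X = k} | B k. B \<in> sets S}"

text \<open>
  The Poisson probabilities are written out since \<open>poisson_pmf\<close> excludes the rate \<open>0\<close>,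
  which occurs for null sets.
\<close>

definition poisson_process :: "'w measure \<Rightarrow> 'a measure \<Rightarrow> ('w \<Rightarrow> 'a multiset) \<Rightarrow> bool" where
  "poisson_process M \<mu> \<Psi> \<longleftrightarrow>
     finite_measure \<mu> \<and>
     \<Psi> \<in> measurable M (configurations \<mu>) \<and>
     (\<forall>B\<in>sets \<mu>. \<forall>k::nat.
        measure M {\<omega>\<in>space M. count_in B (\<Psi> \<omega>) = k}
          = measure \<mu> B ^ k / fact k * exp (- measure \<mu> B)) \<and>
     (\<forall>(n::nat) B. (\<forall>i<n. B i \<in> sets \<mu>) \<and> disjoint_family_on B {..<n} \<longrightarrow>
        prob_space.indep_vars M (\<lambda>_. count_space UNIV) (\<lambda>i \<omega>. count_in (B i) (\<Psi> \<omega>)) {..<n})"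

section \<open>The transmitters and their path losses\<close>

text \<open>
  The plane is the type \<open>complex\<close>; the polar coordinates of \<open>z\<close> are \<open>r = cmod z\<close> and
  \<open>\<theta> = Arg z\<close>.
\<close>

definition wall_prob :: "real \<Rightarrow> nat \<Rightarrow> real \<Rightarrow> real \<Rightarrow> real" where
  "wall_prob lw N r \<theta> =
     (lw * r * \<bar>cos \<theta>\<bar> + lw * r * \<bar>sin \<theta>\<bar>) ^ N / fact N
       * exp (- (lw * r * \<bar>cos \<theta>\<bar> + lw * r * \<bar>sin \<theta>\<bar>))"

definition ph_intensity :: "real \<Rightarrow> real \<Rightarrow> real \<Rightarrow> nat \<Rightarrow> complex measure" where
  "ph_intensity lPH lw R N =
     density (restrict_space lborel (cball 0 R))
       (\<lambda>z. ennreal (lPH * wall_prob lw N (cmod z) (Arg z)))"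

definition path_loss :: "real \<Rightarrow> real \<Rightarrow> real \<Rightarrow> nat \<Rightarrow> real \<Rightarrow> real" where
  "path_loss \<kappa> \<beta> K N r = \<kappa> * r powr \<beta> / K ^ N"

definition loss_process ::
    "real \<Rightarrow> real \<Rightarrow> real \<Rightarrow> nat \<Rightarrow> ('w \<Rightarrow> complex multiset) \<Rightarrow> 'w \<Rightarrow> real multiset" where
  "loss_process \<kappa> \<beta> K N \<Psi> \<omega> = image_mset (\<lambda>z. path_loss \<kappa> \<beta> K N (cmod z)) (\<Psi> \<omega>)"

text \<open>The infimum in \<open>ereal\<close> over no points is \<open>\<infinity>\<close>.\<close>

definition min_loss ::
    "real \<Rightarrow> real \<Rightarrow> real \<Rightarrow> enat \<Rightarrow> (nat \<Rightarrow> 'w \<Rightarrow> complex multiset) \<Rightarrow> 'w \<Rightarrow> ereal" where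
  "min_loss \<kappa> \<beta> K Nmax \<Psi> \<omega> =
     (INF N\<in>{N. enat N \<le> Nmax}. INF z\<in>set_mset (\<Psi> N \<omega>). ereal (path_loss \<kappa> \<beta> K N (cmod z)))"

section \<open>The closed form\<close>

text \<open>The library's hypergeometric power series, summed at \<open>z\<close>; it converges for \<open>\<bar>z\<bar> < 1\<close>.\<close>

definition gauss_hypergeometric :: "real \<Rightarrow> real \<Rightarrow> real \<Rightarrow> real \<Rightarrow> real" where
  "gauss_hypergeometric a b c z = eval_fps (fps_hypergeo [a, b] [c] 1) z"

definition chi :: "real \<Rightarrow> real \<Rightarrow> real" where
  "chi \<eta> lw = lw powr \<eta> *
     (2 powr (\<eta> / 2) * sqrt pi * Gamma ((\<eta> + 1) / 2) / Gamma ((\<eta> + 2) / 2)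
      - sqrt 2 * gauss_hypergeometric (1 / 2) ((\<eta> + 1) / 2) ((\<eta> + 3) / 2) (1 / 2) / (\<eta> + 1))"

definition Lambda_term ::
    "real \<Rightarrow> real \<Rightarrow> real \<Rightarrow> real \<Rightarrow> real \<Rightarrow> nat \<Rightarrow> real \<Rightarrow> nat \<Rightarrow> real" where
  "Lambda_term lw \<kappa> \<beta> K R N \<alpha> \<eta> =
     (-1) ^ (\<eta> - N) * chi (real \<eta>) lw / (fact (\<eta> - N) * (real \<eta> + 2)) *
     (if \<alpha> < R powr \<beta> * \<kappa> / K ^ N
      then (\<alpha> * K ^ N / \<kappa>) powr ((real \<eta> + 2) / \<beta>)
      else R ^ (\<eta> + 2))"

text \<open>The sum over \<open>\<eta> \<ge> N\<close> is written with \<open>\<eta> = j + N\<close>.\<close>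

definition Lambda ::
    "real \<Rightarrow> real \<Rightarrow> real \<Rightarrow> real \<Rightarrow> real \<Rightarrow> real \<Rightarrow> nat \<Rightarrow> real \<Rightarrow> real" where
  "Lambda lPH lw \<kappa> \<beta> K R N \<alpha> =
     4 * lPH / fact N * (\<Sum>j. Lambda_term lw \<kappa> \<beta> K R N \<alpha> (j + N))"

definition prod_upto :: "enat \<Rightarrow> (nat \<Rightarrow> real) \<Rightarrow> real" where
  "prod_upto Nmax f = (case Nmax of enat m \<Rightarrow> (\<Prod>N\<le>m. f N) | \<infinity> \<Rightarrow> (\<Prod>N. f N))"

end

theory Submission
  imports Defs
begin

text \<open>
  Only points of \<open>\<Psi> N\<close> in a disc of radius \<open>min ((\<alpha> K ^ N / \<kappa>) powr (1 / \<beta>)) R\<close> have loss below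
  \<open>\<alpha>\<close>, so the intensity is the integral over that disc of a density in
  \<open>\<bar>x\<bar> + \<bar>y\<bar> = r (\<bar>cos \<theta>\<bar> + \<bar>sin \<theta>\<bar>)\<close>. Expanding the exponential and integrating termwise leaves
  the angular integrals of \<open>(cos \<theta> + sin \<theta>) ^ \<eta> = (sqrt 2 * sin (\<theta> + pi/4)) ^ \<eta>\<close> over \<open>[0, pi/2]\<close>.
  By symmetry they reduce to the integral of \<open>sin ^ \<eta>\<close> over \<open>[pi/4, pi/2]\<close>: the Beta integral over
  \<open>[0, pi/2]\<close> minus the part over \<open>[0, pi/4]\<close>, which the binomial series of \<open>(1 - sin\<^sup>2) powr (-1/2)\<close>
  turns into the hypergeometric term.

  The event \<open>L < \<alpha>\<close> is the complement of an intersection of independent void events. As an infimum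
  over infinitely many \<open>N\<close> may equal \<open>\<alpha>\<close> without being attained, passing to \<open>L \<le> \<alpha>\<close> needs
  right-continuity in \<open>\<alpha>\<close> of the total intensity, which follows from the bound \<open>P\<^sub>N \<le> 1\<close>.
\<close>

section \<open>The angular integrals\<close>

lemma cos_pos_quarter_pi:
  assumes "\<theta> \<in> {0..pi/4}"
  shows "cos \<theta> > 0"
proof (rule cos_gt_zero_pi)
  show "- (pi/2) < \<theta>" "\<theta> < pi/2"
    using assms pi_gt_zero unfolding atLeastAtMost_iff by linarith+
qed

text \<open>Substituting \<open>t = (sin \<theta>)\<^sup>2\<close> in the Beta integral with
  parameters \<open>(n + 1) / 2\<close> and \<open>1/2\<close>: the derivative
  \<open>2 * sin \<theta> * cos \<theta>\<close> cancels the half-integer exponents and leaves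
  \<open>2 * sin \<theta> ^ n\<close>.\<close>

lemma nn_integral_sin_power_half_pi:
  "(\<integral>\<^sup>+\<theta>. ennreal (sin \<theta> ^ n) * indicator {0..pi/2} \<theta> \<partial>lborel)
     = ennreal (Beta ((real n + 1) / 2) (1/2) / 2)"
proof -
  define f :: "real \<Rightarrow> real" where "f = (\<lambda>t. t powr ((real n + 1) / 2 - 1) * (1 - t) powr (1/2 - 1))"
  have [measurable]: "f \<in> borel_measurable borel" unfolding f_def by measurable
  have B: "(f has_integral Beta ((real n + 1) / 2) (1/2)) {0..1}"
    unfolding f_def by (rule has_integral_Beta_real) auto
  have "(\<integral>\<^sup>+t. ennreal (f t * indicator {0..1} t) \<partial>lborel) = ennreal (Beta ((real n + 1) / 2) (1/2))"
  proof (rule nn_integral_has_integral_lborel)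
    have eq: "(\<lambda>t. f t * indicator {0..1} t) = (\<lambda>t. if t \<in> {0..1} then f t else 0)"
      by (auto simp: indicator_def)
    show "((\<lambda>t. f t * indicator {0..1} t) has_integral Beta ((real n + 1) / 2) (1/2)) UNIV"
      unfolding eq has_integral_restrict_UNIV by (rule B)
  qed (auto simp: f_def)
  moreover have "(\<integral>\<^sup>+t. ennreal (f t * indicator {(sin 0)\<^sup>2..(sin (pi/2))\<^sup>2} t) \<partial>lborel) =
      (\<integral>\<^sup>+\<theta>. ennreal (f ((sin \<theta>)\<^sup>2) * (2 * sin \<theta> * cos \<theta>) * indicator {0..pi/2} \<theta>) \<partial>lborel)"
  proof (rule nn_integral_substitution)
    show "set_borel_measurable borel {(sin 0)\<^sup>2..(sin (pi/2))\<^sup>2} f"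
      unfolding set_borel_measurable_def by measurable
    show "((\<lambda>\<theta>. (sin \<theta>)\<^sup>2) has_real_derivative 2 * sin \<theta> * cos \<theta>) (at \<theta>)" for \<theta> :: real
      by (auto intro!: derivative_eq_intros)
    show "0 \<le> 2 * sin \<theta> * cos \<theta>" if "\<theta> \<in> {0..pi/2}" for \<theta>
      using that by (auto intro!: mult_nonneg_nonneg sin_ge_zero cos_ge_zero)
  qed (auto intro!: continuous_intros)
  moreover have "(\<integral>\<^sup>+\<theta>. ennreal (f ((sin \<theta>)\<^sup>2) * (2 * sin \<theta> * cos \<theta>) * indicator {0..pi/2} \<theta>) \<partial>lborel)
      = (\<integral>\<^sup>+\<theta>. 2 * (ennreal (sin \<theta> ^ n) * indicator {0..pi/2} \<theta>) \<partial>lborel)"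
  proof (rule nn_integral_cong_AE)
    \<comment> \<open>Both factors must be positive here. At the endpoints
      \<open>0 powr a = 0\<close> breaks the identity (at \<open>pi/2\<close> the left side is 0 and
      the right side 2), hence equality only almost everywhere.\<close>
    have "f ((sin \<theta>)\<^sup>2) * (2 * sin \<theta> * cos \<theta>) = 2 * sin \<theta> ^ n" if "0 < \<theta>" "\<theta> < pi/2" for \<theta>
    proof -
      have s: "sin \<theta> > 0" and c: "cos \<theta> > 0"
        using that by (auto intro!: sin_gt_zero cos_gt_zero)
      have "((sin \<theta>)\<^sup>2) powr ((real n + 1) / 2 - 1) * sin \<theta> = sin \<theta> powr (real n - 1) * sin \<theta> powr 1"
        using s by (simp add: powr_powr diff_divide_distrib flip: powr_numeral)
      also have "\<dots> = sin \<theta> ^ n"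
        using s by (subst powr_add[symmetric]) (simp add: powr_realpow)
      finally have 1: "((sin \<theta>)\<^sup>2) powr ((real n + 1) / 2 - 1) * sin \<theta> = sin \<theta> ^ n" .
      have "(1 - (sin \<theta>)\<^sup>2) powr (1/2 - 1) = ((cos \<theta>)\<^sup>2) powr (- (1/2))"
        by (simp add: cos_squared_eq)
      also have "\<dots> = cos \<theta> powr (-1)"
        using c by (simp add: powr_powr flip: powr_numeral)
      finally have 2: "(1 - (sin \<theta>)\<^sup>2) powr (1/2 - 1) * cos \<theta> = 1"
        using c by (simp add: powr_minus)
      have "f ((sin \<theta>)\<^sup>2) * (2 * sin \<theta> * cos \<theta>) =
        2 * (((sin \<theta>)\<^sup>2) powr ((real n + 1) / 2 - 1) * sin \<theta>) * ((1 - (sin \<theta>)\<^sup>2) powr (1/2 - 1) * cos \<theta>)"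
        unfolding f_def by (simp only: mult_ac)
      then show ?thesis unfolding 1 2 by simp
    qed
    note eq = this
    show "AE \<theta> in lborel. ennreal (f ((sin \<theta>)\<^sup>2) * (2 * sin \<theta> * cos \<theta>) * indicator {0..pi/2} \<theta>)
        = 2 * (ennreal (sin \<theta> ^ n) * indicator {0..pi/2} \<theta>)"
      using AE_lborel_singleton[of 0] AE_lborel_singleton[of "pi/2"]
      by eventually_elim (auto simp: indicator_def eq ennreal_mult')
  qed
  moreover have "\<dots> = 2 * (\<integral>\<^sup>+\<theta>. ennreal (sin \<theta> ^ n) * indicator {0..pi/2} \<theta> \<partial>lborel)"
    by (rule nn_integral_cmult) auto
  ultimately have "2 * (\<integral>\<^sup>+\<theta>. ennreal (sin \<theta> ^ n) * indicator {0..pi/2} \<theta> \<partial>lborel)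
      = ennreal (Beta ((real n + 1) / 2) (1/2))"
    by simp
  then have "2 * (\<integral>\<^sup>+\<theta>. ennreal (sin \<theta> ^ n) * indicator {0..pi/2} \<theta> \<partial>lborel)
      = 2 * ennreal (Beta ((real n + 1) / 2) (1/2) / 2)"
    by (simp flip: ennreal_mult' ennreal_numeral)
  then show ?thesis
    by (simp add: ennreal_mult_cancel_left)
qed

text \<open>Write \<open>sin \<theta> ^ n\<close> as \<open>sin \<theta> ^ n * cos \<theta> * (1 -
  (sin \<theta>)\<^sup>2) powr (-1/2)\<close> and expand the last factor. Each term
  \<open>sin \<theta> ^ (n + 2 * k) * cos \<theta>\<close> has an elementary antiderivative, and all
  terms are nonnegative, so sum and integral commute. The two claims share a proof because both rest
  on the summability of the same hypergeometric series.\<close>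

lemma
  shows gauss_hypergeometric_half_nonneg:
      "0 \<le> gauss_hypergeometric (1/2) ((real n + 1) / 2) ((real n + 3) / 2) (1/2)"
    and nn_integral_sin_power_quarter_pi:
  "(\<integral>\<^sup>+\<theta>. ennreal (sin \<theta> ^ n) * indicator {0..pi/4} \<theta> \<partial>lborel)
     = ennreal ((sqrt 2 / 2) ^ (n + 1) / (real n + 1) *
         gauss_hypergeometric (1/2) ((real n + 1) / 2) ((real n + 3) / 2) (1/2))"
proof -
  \<comment> \<open>The coefficients of the binomial series of
    \<open>(1 - x) powr (-1/2)\<close>.\<close>
  define c :: "nat \<Rightarrow> real" where "c = (\<lambda>k. pochhammer (1/2) k / fact k)"
  have c_nonneg: "0 \<le> c k" for k
    unfolding c_def by (auto intro!: divide_nonneg_nonneg pochhammer_nonneg)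
  have gb: "(- (1/2) :: real) gchoose k = (-1) ^ k * c k" for k
    unfolding c_def by (subst gbinomial_pochhammer) simp
  have ser: "(\<lambda>k. c k * x ^ k) sums (1 - x) powr (-1/2)" if "\<bar>x\<bar> < 1" for x
  proof -
    have "(- (1/2) gchoose k) * (- x) ^ k = c k * x ^ k" for k
    proof -
      have "(- (1/2) gchoose k) * (- x) ^ k = ((-1) ^ k * (-1) ^ k) * (c k * x ^ k)"
        unfolding gb by (subst power_minus) (simp only: mult_ac)
      then show ?thesis by (simp flip: power_mult_distrib)
    qed
    then show ?thesis
      using gen_binomial_real[of "-x" "-(1/2)"] that by simp
  qed
  have summand: "(\<integral>\<^sup>+\<theta>. ennreal (c k * sin \<theta> ^ (n + 2 * k) * cos \<theta>) * indicator {0..pi/4} \<theta> \<partial>lborel)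
      = ennreal (c k * (sqrt 2 / 2) ^ (n + 2 * k + 1) / (real n + 2 * real k + 1))" for k
  proof -
    have "(\<integral>\<^sup>+\<theta>. ennreal (c k * sin \<theta> ^ (n + 2 * k) * cos \<theta>) * indicator {0..pi/4} \<theta> \<partial>lborel)
      = ennreal (c k * sin (pi/4) ^ (n + 2 * k + 1) / (real n + 2 * real k + 1)
               - c k * sin 0 ^ (n + 2 * k + 1) / (real n + 2 * real k + 1))"
    proof (rule nn_integral_FTC_Icc[where F = "\<lambda>\<theta>. c k * sin \<theta> ^ (n + 2 * k + 1) / (real n + 2 * real k + 1)"])
      show "((\<lambda>\<theta>. c k * sin \<theta> ^ (n + 2 * k + 1) / (real n + 2 * real k + 1))
         has_real_derivative c k * sin \<theta> ^ (n + 2 * k) * cos \<theta>) (at \<theta>)" for \<theta>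
      proof -
        define m where "m = n + 2 * k"
        have "((\<lambda>\<theta>. sin \<theta> ^ Suc m) has_real_derivative real (Suc m) * (cos \<theta> * sin \<theta> ^ m)) (at \<theta>)"
          using DERIV_power[OF DERIV_sin[of \<theta>], of "Suc m"] by (simp only: diff_Suc_Suc diff_zero)
        from DERIV_cmult[OF this, of "c k / real (Suc m)"]
        have "((\<lambda>\<theta>. c k / real (Suc m) * sin \<theta> ^ Suc m) has_real_derivative c k * sin \<theta> ^ m * cos \<theta>) (at \<theta>)"
          by (simp del: of_nat_Suc power_Suc add: mult_ac)
        moreover have "real n + 2 * real k + 1 = real (Suc m)" "n + 2 * k + 1 = Suc m"
          by (simp_all add: m_def)
        ultimately show ?thesis
          unfolding m_def[symmetric] by (simp only: times_divide_eq_left)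
      qed
      show "0 \<le> c k * sin \<theta> ^ (n + 2 * k) * cos \<theta>" if "\<theta> \<in> {0..pi/4}" for \<theta>
        using that c_nonneg
        by (auto intro!: mult_nonneg_nonneg zero_le_power sin_ge_zero cos_ge_zero)
    qed auto
    then show ?thesis by (simp add: sin_45)
  qed
  \<comment> \<open>With \<open>a = (n + 1) / 2\<close> the ratio of the Pochhammer symbols of
    \<open>a\<close> and \<open>a + 1\<close> telescopes to \<open>a / (a + k)\<close>, which is
    \<open>(n + 1) / (n + 2 * k + 1)\<close>, the factor produced by the antiderivative. The
    argument 1/2 is \<open>(sqrt 2 / 2)\<^sup>2\<close>, the squared sine at the upper
    limit.\<close>
  have coeff: "(sqrt 2 / 2) ^ (n + 1) / (real n + 1) *
      (fps_nth (fps_hypergeo [1/2, (real n + 1) / 2] [(real n + 3) / 2] 1) k * (1/2) ^ k)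
      = c k * (sqrt 2 / 2) ^ (n + 2 * k + 1) / (real n + 2 * real k + 1)" for k
  proof -
    define a where "a = (real n + 1) / 2"
    have a: "a > 0" "(real n + 3) / 2 = a + 1" "real n + 1 = 2 * a"
      by (simp_all add: a_def field_simps)
    have "a * pochhammer (a + 1) k = pochhammer a k * (a + real k)"
      by (simp flip: pochhammer_rec pochhammer_Suc)
    moreover have "pochhammer (a + 1) k > 0" "a + real k > 0"
      using a by (auto intro!: pochhammer_pos)
    ultimately have p: "pochhammer a k / pochhammer (a + 1) k = a / (a + real k)"
      by (simp add: field_simps)
    have 1: "fps_nth (fps_hypergeo [1/2, a] [a + 1] 1) k = c k * (a / (a + real k))"
      unfolding p[symmetric] by (simp add: c_def field_simps)
    have 2: "(sqrt 2 / 2) ^ (n + 2 * k + 1) = (sqrt 2 / 2) ^ (n + 1) * ((1/2) ^ k :: real)"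
      by (simp add: power_add power_mult power_divide)
    have 3: "real n + 2 * real k + 1 = 2 * (a + real k)"
      by (simp add: a_def field_simps)
    have "S / (2 * a) * (c k * (a / (a + real k)) * h) = c k * (S * h) / (2 * (a + real k))" for S h
      using a(1) by (simp add: field_simps)
    then show ?thesis
      unfolding a_def[symmetric] a(2) unfolding 1 2 3 unfolding a(3) .
  qed
  \<comment> \<open>Dominated by the binomial series at \<open>x = 1/2\<close>: what remains of each
    term, \<open>(sqrt 2 / 2) ^ (n + 1) / (n + 2 * k + 1)\<close>, is at most 1.\<close>
  have "summable (\<lambda>k. c k * (sqrt 2 / 2) ^ (n + 2 * k + 1) / (real n + 2 * real k + 1))"
  proof (rule summable_comparison_test')
    show "summable (\<lambda>k. c k * (1/2) ^ k)"
      using ser[of "1/2"] by (auto dest: sums_summable)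
    show "norm (c k * (sqrt 2 / 2) ^ (n + 2 * k + 1) / (real n + 2 * real k + 1)) \<le> c k * (1/2) ^ k"
      for k
    proof -
      have "(sqrt 2 / 2 :: real) ^ (n + 1) \<le> 1"
        by (rule power_le_one) (auto simp: real_le_lsqrt)
      moreover have "S / d \<le> 1" if "S \<le> 1" "1 \<le> d" for S d :: real
        using that by (simp add: divide_le_eq)
      ultimately have "(sqrt 2 / 2) ^ (n + 1) / (real n + 2 * real k + 1) \<le> 1"
        by auto
      then have "(c k * (1/2)^k) * ((sqrt 2 / 2) ^ (n + 1) / (real n + 2 * real k + 1)) \<le> (c k * (1/2)^k) * 1"
        using c_nonneg[of k] by (intro mult_left_mono) auto
      moreover have "(sqrt 2 / 2) ^ (n + 2 * k + 1) = (sqrt 2 / 2) ^ (n + 1) * ((1/2) ^ k :: real)"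
        by (simp add: power_add power_mult power_divide)
      ultimately show ?thesis
        using c_nonneg[of k] by (simp add: abs_mult mult_ac)
    qed
  qed
  note summ = this
  have sm2: "summable (\<lambda>k. fps_nth (fps_hypergeo [1/2, (real n + 1) / 2] [(real n + 3) / 2] 1) k * (1/2) ^ k)"
  proof -
    have "summable (\<lambda>k. (sqrt 2 / 2) ^ (n + 1) / (real n + 1) *
      (fps_nth (fps_hypergeo [1/2, (real n + 1) / 2] [(real n + 3) / 2] 1) k * (1/2) ^ k))"
      unfolding coeff by (rule summ)
    then show ?thesis
      by (subst (asm) summable_cmult_iff) auto
  qed
  show "0 \<le> gauss_hypergeometric (1/2) ((real n + 1) / 2) ((real n + 3) / 2) (1/2)"
    unfolding gauss_hypergeometric_def eval_fps_def
    by (rule suminf_nonneg[OF sm2])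
       (auto intro!: mult_nonneg_nonneg divide_nonneg_nonneg pochhammer_nonneg)
  have "(\<integral>\<^sup>+\<theta>. ennreal (sin \<theta> ^ n) * indicator {0..pi/4} \<theta> \<partial>lborel)
    = (\<integral>\<^sup>+\<theta>. (\<Sum>k. ennreal (c k * sin \<theta> ^ (n + 2 * k) * cos \<theta>) * indicator {0..pi/4} \<theta>) \<partial>lborel)"
  proof (rule nn_integral_cong)
    fix \<theta> :: real
    show "ennreal (sin \<theta> ^ n) * indicator {0..pi/4} \<theta>
      = (\<Sum>k. ennreal (c k * sin \<theta> ^ (n + 2 * k) * cos \<theta>) * indicator {0..pi/4} \<theta>)"
    proof (cases "\<theta> \<in> {0..pi/4}")
      case True
      then have s: "sin \<theta> \<ge> 0" and c: "cos \<theta> > 0"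
        by (auto intro!: sin_ge_zero cos_pos_quarter_pi)
      have "(sin \<theta>)\<^sup>2 < 1" using c by (simp add: sin_squared_eq)
      then have "\<bar>(sin \<theta>)\<^sup>2\<bar> < 1" by simp
      from ser[OF this] have "(\<lambda>k. c k * ((sin \<theta>)\<^sup>2) ^ k) sums (((cos \<theta>)\<^sup>2) powr (-1/2))"
        by (simp add: cos_squared_eq)
      moreover have "((cos \<theta>)\<^sup>2) powr (-1/2) = inverse (cos \<theta>)"
        using c by (simp add: powr_powr powr_minus flip: powr_numeral)
      ultimately have "(\<lambda>k. sin \<theta> ^ n * cos \<theta> * (c k * ((sin \<theta>)\<^sup>2) ^ k)) sums (sin \<theta> ^ n * cos \<theta> * inverse (cos \<theta>))"
        by (intro sums_mult) simp
      moreover have "sin \<theta> ^ n * cos \<theta> * (c k * ((sin \<theta>)\<^sup>2) ^ k) = c k * sin \<theta> ^ (n + 2 * k) * cos \<theta>" for k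
        unfolding power_add power_mult by (simp only: mult_ac)
      ultimately have "(\<lambda>k. c k * sin \<theta> ^ (n + 2 * k) * cos \<theta>) sums (sin \<theta> ^ n)"
        using c by (simp only: mult.assoc right_inverse mult_1_right)
      then have "(\<Sum>k. ennreal (c k * sin \<theta> ^ (n + 2 * k) * cos \<theta>)) = ennreal (sin \<theta> ^ n)"
        using s c c_nonneg by (intro suminf_ennreal_eq) (auto intro!: mult_nonneg_nonneg)
      with True show ?thesis by simp
    qed simp
  qed
  also have "\<dots> = (\<Sum>k. \<integral>\<^sup>+\<theta>. ennreal (c k * sin \<theta> ^ (n + 2 * k) * cos \<theta>) * indicator {0..pi/4} \<theta> \<partial>lborel)"
    by (rule nn_integral_suminf) measurable
  also have "\<dots> = ennreal (\<Sum>k. c k * (sqrt 2 / 2) ^ (n + 2 * k + 1) / (real n + 2 * real k + 1))"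
    unfolding summand using summ c_nonneg by (intro suminf_ennreal2) auto
  also have "(\<Sum>k. c k * (sqrt 2 / 2) ^ (n + 2 * k + 1) / (real n + 2 * real k + 1))
    = (sqrt 2 / 2) ^ (n + 1) / (real n + 1) *
         gauss_hypergeometric (1/2) ((real n + 1) / 2) ((real n + 3) / 2) (1/2)"
    unfolding gauss_hypergeometric_def eval_fps_def coeff[symmetric]
    using sm2 by (rule suminf_mult)
  finally show "(\<integral>\<^sup>+\<theta>. ennreal (sin \<theta> ^ n) * indicator {0..pi/4} \<theta> \<partial>lborel)
     = ennreal ((sqrt 2 / 2) ^ (n + 1) / (real n + 1) *
         gauss_hypergeometric (1/2) ((real n + 1) / 2) ((real n + 3) / 2) (1/2))" .
qed

text \<open>Allows all angular and disc integrals to be computed at \<open>lw = 1\<close>; the power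
  of \<open>lw\<close> returns only when the series is assembled.\<close>

lemma chi_eq_power_mult: "lw > 0 \<Longrightarrow> chi (real n) lw = lw ^ n * chi (real n) 1"
  by (simp add: chi_def powr_realpow)

text \<open>\<open>cos + sin\<close> is \<open>sqrt 2\<close> times the sine shifted by
  \<open>pi/4\<close>, so the integral is \<open>sqrt 2 ^ n\<close> times that of
  \<open>sin ^ n\<close> over \<open>[pi/4, pi/2]\<close>, a difference of the two preceding
  integrals. The factor 1/2 appears because \<open>cos + sin\<close> is symmetric about
  \<open>pi/4\<close>: the full quarter turn would give \<open>chi\<close>.\<close>

lemma
  shows chi_nonneg: "0 \<le> chi (real n) 1"
    and nn_integral_cos_plus_sin_power:
      "(\<integral>\<^sup>+\<theta>. ennreal ((cos \<theta> + sin \<theta>) ^ n) * indicator {0..pi/4} \<theta> \<partial>lborel) = ennreal (chi (real n) 1 / 2)"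
proof -
  define A where "A = Beta ((real n + 1) / 2) (1/2) / 2"
  define B where "B = (sqrt 2 / 2) ^ (n + 1) / (real n + 1) *
         gauss_hypergeometric (1/2) ((real n + 1) / 2) ((real n + 3) / 2) (1/2)"
  define X where "X = (\<integral>\<^sup>+\<theta>. ennreal (sin \<theta> ^ n) * indicator {pi/4..pi/2} \<theta> \<partial>lborel)"
  have A0: "A \<ge> 0" by (auto simp: A_def Beta_def intro!: divide_nonneg_nonneg mult_nonneg_nonneg Gamma_real_nonneg add_nonneg_pos)
  have B0: "B \<ge> 0"
    using gauss_hypergeometric_half_nonneg[of n] by (simp add: B_def)
  have "ennreal A = (\<integral>\<^sup>+\<theta>. ennreal (sin \<theta> ^ n) * indicator {0..pi/4} \<theta>
      + ennreal (sin \<theta> ^ n) * indicator {pi/4..pi/2} \<theta> \<partial>lborel)"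
    unfolding A_def nn_integral_sin_power_half_pi[symmetric]
  proof (rule nn_integral_cong_AE)
    show "AE \<theta> in lborel. ennreal (sin \<theta> ^ n) * indicator {0..pi/2} \<theta>
      = ennreal (sin \<theta> ^ n) * indicator {0..pi/4} \<theta> + ennreal (sin \<theta> ^ n) * indicator {pi/4..pi/2} \<theta>"
      using AE_lborel_singleton[of "pi/4"]
      by eventually_elim (auto simp: indicator_def)
  qed
  also have "\<dots> = ennreal B + X"
    unfolding X_def B_def nn_integral_sin_power_quarter_pi[symmetric]
    by (rule nn_integral_add) auto
  finally have AB: "ennreal A = ennreal B + X" .
  then have X: "X = ennreal (A - B)"
    using B0 by (simp add: ennreal_minus ennreal_add_diff_cancel_left flip: ennreal_minus)
  \<comment> \<open>\<open>ennreal\<close> truncates negative reals to 0, so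
    \<open>X = ennreal (A - B)\<close> alone does not give the sign of \<open>A - B\<close>. It is
    read off from \<open>AB\<close> instead.\<close>
  have "ennreal B \<le> ennreal A" unfolding AB by simp
  then have "B \<le> A" using A0 by simp
  have eq: "chi (real n) 1 / 2 = sqrt 2 ^ n * (A - B)"
  proof -
    have s: "sqrt 2 ^ n = 2 powr (real n / 2)"
      by (simp add: powr_half_sqrt_powr powr_realpow real_sqrt_power)
    have h: "(real n + 1) / 2 + 1 / 2 = (real n + 2) / 2" by (simp add: field_simps)
    \<comment> \<open>All powers of \<open>sqrt 2\<close> but one cancel; this is why the
      hypergeometric term of \<open>chi\<close> carries only \<open>sqrt 2\<close> while the Gamma
      term keeps \<open>2 powr (\<eta> / 2)\<close>.\<close>
    have "sqrt 2 ^ n * (sqrt 2 / 2) ^ (n + 1) = (sqrt 2 * (sqrt 2 / 2)) ^ n * (sqrt 2 / 2 :: real)"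
      by (simp only: power_mult_distrib power_add power_one_right mult.assoc)
    then have s2: "sqrt 2 ^ n * (sqrt 2 / 2) ^ (n + 1) = (sqrt 2 / 2 :: real)" by simp
    have "sqrt 2 ^ n * B = (sqrt 2 ^ n * (sqrt 2 / 2) ^ (n + 1)) / (real n + 1) *
         gauss_hypergeometric (1/2) ((real n + 1) / 2) ((real n + 3) / 2) (1/2)"
      by (simp add: B_def)
    then have "sqrt 2 ^ n * B = (sqrt 2 / 2) / (real n + 1) *
         gauss_hypergeometric (1/2) ((real n + 1) / 2) ((real n + 3) / 2) (1/2)"
      unfolding s2 .
    moreover have "sqrt 2 ^ n * A = 2 powr (real n / 2) * sqrt pi * Gamma ((real n + 1) / 2) / Gamma ((real n + 2) / 2) / 2"
      by (simp add: A_def Beta_def s h Gamma_one_half_real)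
    ultimately show ?thesis
      by (simp add: chi_def right_diff_distrib diff_divide_distrib)
  qed
  show "0 \<le> chi (real n) 1"
    using zero_le_mult_iff[of "sqrt 2 ^ n" "A - B"] eq \<open>B \<le> A\<close> by simp
  have "cos \<theta> + sin \<theta> = sqrt 2 * sin (pi/4 + \<theta>)" for \<theta> :: real
    by (simp add: sin_add sin_45 cos_45 distrib_left flip: mult.assoc)
  \<comment> \<open>The argument is kept as \<open>pi/4 + 1 * \<theta>\<close>, the affine form in
    which \<open>nn_integral_real_affine\<close> expects it.\<close>
  then have "(\<integral>\<^sup>+\<theta>. ennreal ((cos \<theta> + sin \<theta>) ^ n) * indicator {0..pi/4} \<theta> \<partial>lborel)
     = (\<integral>\<^sup>+\<theta>. ennreal (sqrt 2 ^ n) * (ennreal (sin (pi/4 + 1 * \<theta>) ^ n) * indicator {pi/4..pi/2} (pi/4 + 1 * \<theta>)) \<partial>lborel)"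
    by (intro nn_integral_cong)
       (auto simp: indicator_def power_mult_distrib ennreal_mult' zero_le_power)
  also have "\<dots> = ennreal (sqrt 2 ^ n) * (\<integral>\<^sup>+\<theta>. (ennreal (sin (pi/4 + 1 * \<theta>) ^ n) * indicator {pi/4..pi/2} (pi/4 + 1 * \<theta>)) \<partial>lborel)"
    by (rule nn_integral_cmult) auto
  also have "(\<integral>\<^sup>+\<theta>. (ennreal (sin (pi/4 + 1 * \<theta>) ^ n) * indicator {pi/4..pi/2} (pi/4 + 1 * \<theta>)) \<partial>lborel) = X"
    unfolding X_def using nn_integral_real_affine[of "\<lambda>\<theta>. ennreal (sin \<theta> ^ n) * indicator {pi/4..pi/2} \<theta>" 1 "pi/4"] by simp
  finally show "(\<integral>\<^sup>+\<theta>. ennreal ((cos \<theta> + sin \<theta>) ^ n) * indicator {0..pi/4} \<theta> \<partial>lborel) = ennreal (chi (real n) 1 / 2)"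
    unfolding X eq by (simp add: ennreal_mult')
qed

section \<open>Integration over discs\<close>

lemma Complex_measurable [measurable]:
  "(\<lambda>(x, y). Complex x y) \<in> borel_measurable (borel :: (real \<times> real) measure)"
  unfolding case_prod_beta
  by (intro borel_measurable_continuous_onI) (simp add: Complex_eq, intro continuous_intros)

text \<open>Lebesgue measure is determined by its values on boxes, and \<open>Complex\<close> pulls
  a box back to a box with the same side lengths. This carries iterated integration over to the
  complex plane.\<close>

lemma lborel_complex_eq_distr:
  "(lborel :: complex measure) = distr (lborel :: (real \<times> real) measure) borel (\<lambda>(x, y). Complex x y)"
proof (rule lborel_eqI)
  fix l u :: complex
  assume le: "\<And>b. b \<in> Basis \<Longrightarrow> l \<bullet> b \<le> u \<bullet> b"
  have le': "Re l \<le> Re u" "Im l \<le> Im u"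
    using le[of 1] le[of \<i>] by (auto simp: Basis_complex_def)
  have eq: "(\<lambda>(x, y). Complex x y) -` box l u = box (Re l, Im l) (Re u, Im u)"
    by (auto simp: box_def Basis_complex_def Basis_prod_def)
  have "emeasure (distr (lborel :: (real \<times> real) measure) borel (\<lambda>(x, y). Complex x y)) (box l u)
      = emeasure lborel (box (Re l, Im l) (Re u, Im u))"
    by (subst emeasure_distr) (auto simp: eq)
  also have "\<dots> = (\<Prod>b\<in>Basis. ((Re u, Im u) - (Re l, Im l)) \<bullet> b)"
    using le' by (intro emeasure_lborel_box) (auto simp: Basis_prod_def)
  also have "\<dots> = (\<Prod>b\<in>Basis. (u - l) \<bullet> b)"
    by (simp add: Basis_complex_def Basis_prod_def mult.commute)
  finally show "emeasure (distr (lborel :: (real \<times> real) measure) borel (\<lambda>(x, y). Complex x y)) (box l u)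
     = (\<Prod>b\<in>Basis. (u - l) \<bullet> b)" .
qed simp

lemma nn_integral_lborel_complex:
  fixes f :: "complex \<Rightarrow> ennreal"
  assumes [measurable]: "f \<in> borel_measurable borel"
  shows "(\<integral>\<^sup>+z. f z \<partial>lborel) = (\<integral>\<^sup>+x. \<integral>\<^sup>+y. f (Complex x y) \<partial>lborel \<partial>lborel)"
proof -
  have "(\<integral>\<^sup>+z. f z \<partial>lborel) = (\<integral>\<^sup>+p. f (case p of (x, y) \<Rightarrow> Complex x y) \<partial>(lborel \<Otimes>\<^sub>M lborel))"
    by (subst lborel_complex_eq_distr, subst nn_integral_distr) (auto simp: lborel_prod)
  also have "\<dots> = (\<integral>\<^sup>+x. \<integral>\<^sup>+y. f (case (x, y) of (x, y) \<Rightarrow> Complex x y) \<partial>lborel \<partial>lborel)"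
    by (rule lborel.nn_integral_fst[symmetric])
       (use measurable_compose[OF Complex_measurable assms] in \<open>simp add: lborel_prod\<close>)
  finally show ?thesis by simp
qed

text \<open>Drop the null point 0 and reflect the negative half-line. Applied once per coordinate,
  it reduces the disc to a quadrant.\<close>

lemma nn_integral_abs:
  fixes f :: "real \<Rightarrow> ennreal"
  assumes [measurable]: "f \<in> borel_measurable borel"
  shows "(\<integral>\<^sup>+x. f \<bar>x\<bar> \<partial>lborel) = 2 * (\<integral>\<^sup>+x. f x * indicator {0<..} x \<partial>lborel)"
proof -
  have "(\<integral>\<^sup>+x. f \<bar>x\<bar> \<partial>lborel)
      = (\<integral>\<^sup>+x. f x * indicator {0<..} x + f (0 + (-1) * x) * indicator {0<..} (0 + (-1) * x) \<partial>lborel)"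
    by (rule nn_integral_cong_AE, use AE_lborel_singleton[of 0] in eventually_elim)
       (auto simp: indicator_def abs_if)
  also have "\<dots> = (\<integral>\<^sup>+x. f x * indicator {0<..} x \<partial>lborel)
      + (\<integral>\<^sup>+x. f (0 + (-1) * x) * indicator {0<..} (0 + (-1) * x) \<partial>lborel)"
    by (rule nn_integral_add) auto
  also have "(\<integral>\<^sup>+x. f (0 + (-1) * x) * indicator {0<..} (0 + (-1) * x) \<partial>lborel)
      = (\<integral>\<^sup>+x. f x * indicator {0<..} x \<partial>lborel)"
    by (subst (2) nn_integral_real_affine[where c = "-1" and t = 0]) auto
  finally show ?thesis by (simp add: mult_2)
qed

text \<open>The octant \<open>0 < y < x\<close> is parametrised by \<open>x\<close> and the slope \<open>t = y / x\<close>; integrating out \<open>x\<close>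
  first leaves the angular integral in the variable \<open>t = tan \<theta>\<close>.\<close>

lemma nn_integral_octant:
  fixes \<rho> :: real
  assumes "\<rho> > 0"
  shows "(\<integral>\<^sup>+x. \<integral>\<^sup>+y. ennreal ((x + y) ^ n) * indicator {y. x\<^sup>2 + y\<^sup>2 < \<rho>\<^sup>2 \<and> 0 < y \<and> y < x} y \<partial>lborel \<partial>lborel)
    = ennreal (\<rho> ^ (n + 2) / (real n + 2)) *
        (\<integral>\<^sup>+\<theta>. ennreal ((cos \<theta> + sin \<theta>) ^ n) * indicator {0..pi/4} \<theta> \<partial>lborel)"
proof -
  \<comment> \<open>On the ray of slope \<open>t\<close> the point \<open>(x, x * t)\<close> has
    norm \<open>x * sqrt (1 + t\<^sup>2)\<close>, so \<open>b t\<close> is the abscissa at which the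
    ray leaves the disc.\<close>
  define b where "b = (\<lambda>t::real. \<rho> / sqrt (1 + t\<^sup>2))"
  have pos: "1 + t\<^sup>2 > 0" for t :: real by (simp add: add_pos_nonneg)
  have bpos: "b t > 0" for t using assms pos[of t] by (simp add: b_def)
  have "(\<integral>\<^sup>+x. \<integral>\<^sup>+y. ennreal ((x + y) ^ n) * indicator {y. x\<^sup>2 + y\<^sup>2 < \<rho>\<^sup>2 \<and> 0 < y \<and> y < x} y \<partial>lborel \<partial>lborel)
    = (\<integral>\<^sup>+x. \<integral>\<^sup>+t. ennreal (x ^ (n + 1) * (1 + t) ^ n) * indicator {0<..<b t} x * indicator {0<..<1} t \<partial>lborel \<partial>lborel)"
  proof (rule nn_integral_cong)
    fix x :: real
    show "(\<integral>\<^sup>+y. ennreal ((x + y) ^ n) * indicator {y. x\<^sup>2 + y\<^sup>2 < \<rho>\<^sup>2 \<and> 0 < y \<and> y < x} y \<partial>lborel)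
      = (\<integral>\<^sup>+t. ennreal (x ^ (n + 1) * (1 + t) ^ n) * indicator {0<..<b t} x * indicator {0<..<1} t \<partial>lborel)"
    proof (cases "x > 0")
      case True
      \<comment> \<open>Substitute \<open>y = x * t\<close>; the Jacobian \<open>x\<close> raises
        the exponent of \<open>x\<close> to \<open>n + 1\<close>.\<close>
      have "(\<integral>\<^sup>+y. ennreal ((x + y) ^ n) * indicator {y. x\<^sup>2 + y\<^sup>2 < \<rho>\<^sup>2 \<and> 0 < y \<and> y < x} y \<partial>lborel)
        = ennreal \<bar>x\<bar> * (\<integral>\<^sup>+t. ennreal ((x + (0 + x * t)) ^ n) * indicator {y. x\<^sup>2 + y\<^sup>2 < \<rho>\<^sup>2 \<and> 0 < y \<and> y < x} (0 + x * t) \<partial>lborel)"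
        using True by (intro nn_integral_real_affine) auto
      also have "\<dots> = (\<integral>\<^sup>+t. ennreal \<bar>x\<bar> * (ennreal ((x + (0 + x * t)) ^ n) * indicator {y. x\<^sup>2 + y\<^sup>2 < \<rho>\<^sup>2 \<and> 0 < y \<and> y < x} (0 + x * t)) \<partial>lborel)"
        by (rule nn_integral_cmult[symmetric]) auto
      also have "\<dots> = (\<integral>\<^sup>+t. ennreal (x ^ (n + 1) * (1 + t) ^ n) * indicator {0<..<b t} x * indicator {0<..<1} t \<partial>lborel)"
      proof (rule nn_integral_cong)
        fix t :: real
        have "x\<^sup>2 + (x * t)\<^sup>2 < \<rho>\<^sup>2 \<longleftrightarrow> x < b t"
        proof -
          have "x\<^sup>2 + (x * t)\<^sup>2 = (x * sqrt (1 + t\<^sup>2))\<^sup>2"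
            using pos[of t] by (simp add: power_mult_distrib algebra_simps)
          then have "x\<^sup>2 + (x * t)\<^sup>2 < \<rho>\<^sup>2 \<longleftrightarrow> x * sqrt (1 + t\<^sup>2) < \<rho>"
            using assms True pos[of t] by (simp add: not_le[symmetric])
          then show ?thesis
            unfolding b_def using pos[of t] by (simp add: pos_less_divide_eq)
        qed
        then have *: "0 + x * t \<in> {y. x\<^sup>2 + y\<^sup>2 < \<rho>\<^sup>2 \<and> 0 < y \<and> y < x} \<longleftrightarrow> x \<in> {0<..<b t} \<and> t \<in> {0<..<1}"
          using True by (auto simp: zero_less_mult_iff)
        have "x * (x + x * t) ^ n = x ^ (n + 1) * (1 + t) ^ n"
          by (simp add: power_mult_distrib[symmetric] distrib_left)
        then show "ennreal \<bar>x\<bar> * (ennreal ((x + (0 + x * t)) ^ n) * indicator {y. x\<^sup>2 + y\<^sup>2 < \<rho>\<^sup>2 \<and> 0 < y \<and> y < x} (0 + x * t))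
          = ennreal (x ^ (n + 1) * (1 + t) ^ n) * indicator {0<..<b t} x * indicator {0<..<1} t"
          using True * by (auto simp: indicator_def simp flip: ennreal_mult')
      qed
      finally show ?thesis .
    next
      case False
      then have empty: "{y. x\<^sup>2 + y\<^sup>2 < \<rho>\<^sup>2 \<and> 0 < y \<and> y < x} = {}" by auto
      from False show ?thesis unfolding empty by simp
    qed
  qed
  also have "\<dots> = (\<integral>\<^sup>+t. \<integral>\<^sup>+x. ennreal (x ^ (n + 1) * (1 + t) ^ n) * indicator {0<..<b t} x * indicator {0<..<1} t \<partial>lborel \<partial>lborel)"
    unfolding b_def greaterThanLessThan_def greaterThan_def lessThan_def
    by (rule lborel_pair.Fubini') measurable
  also have "\<dots> = (\<integral>\<^sup>+t. ennreal (\<rho> ^ (n + 2) / (real n + 2)) *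
      ennreal ((1 + t) ^ n / sqrt (1 + t\<^sup>2) ^ (n + 2) * indicator {0..1} t) \<partial>lborel)"
  proof (rule nn_integral_cong_AE)
    \<comment> \<open>The slopes 0 and 1 are discarded to pass from the open interval to the closed
      one that the substitution \<open>t = tan \<theta>\<close> requires.\<close>
    have main: "(\<integral>\<^sup>+x. ennreal (x ^ (n + 1) * (1 + t) ^ n) * indicator {0<..<b t} x * indicator {0<..<1} t \<partial>lborel)
      = ennreal (\<rho> ^ (n + 2) / (real n + 2)) * ennreal ((1 + t) ^ n / sqrt (1 + t\<^sup>2) ^ (n + 2) * indicator {0..1} t)"
      if t: "t \<noteq> 0" "t \<noteq> 1" for t
    proof (cases "t \<in> {0<..<1}")
      case True
      have "(\<integral>\<^sup>+x. ennreal (x ^ (n + 1) * (1 + t) ^ n) * indicator {0<..<b t} x * indicator {0<..<1} t \<partial>lborel)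
        = (\<integral>\<^sup>+x. ennreal (x ^ (n + 1) * (1 + t) ^ n) * indicator {0..b t} x \<partial>lborel)"
        by (rule nn_integral_cong_AE,
            use AE_lborel_singleton[of 0] AE_lborel_singleton[of "b t"] in eventually_elim)
           (use True in \<open>auto simp: indicator_def\<close>)
      also have "\<dots> = ennreal (b t ^ (n + 2) / (real n + 2) * (1 + t) ^ n - 0 ^ (n + 2) / (real n + 2) * (1 + t) ^ n)"
      proof (rule nn_integral_FTC_Icc[where F = "\<lambda>x. x ^ (n + 2) / (real n + 2) * (1 + t) ^ n"])
        show "((\<lambda>x. x ^ (n + 2) / (real n + 2) * (1 + t) ^ n) has_real_derivative x ^ (n + 1) * (1 + t) ^ n) (at x)" for x
        proof -
          have "((\<lambda>x. x ^ (n + 2)) has_real_derivative (real n + 2) * x ^ (n + 1)) (at x)"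
            using DERIV_pow[of "n + 2" x] by (simp add: add.commute)
          from DERIV_cmult[OF this, of "(1 + t) ^ n / (real n + 2)"]
          moreover have "C / m * (m * X) = X * C" if "m > 0" for C m X :: real
            using that by simp
          ultimately have "((\<lambda>x. (1 + t) ^ n / (real n + 2) * x ^ (n + 2)) has_real_derivative x ^ (n + 1) * (1 + t) ^ n) (at x)"
            by (simp only: add_nonneg_pos of_nat_0_le_iff zero_less_numeral)
          moreover have "(\<lambda>x. (1 + t) ^ n / (real n + 2) * x ^ (n + 2)) = (\<lambda>x. x ^ (n + 2) / (real n + 2) * (1 + t) ^ n)"
            by (simp add: mult_ac)
          ultimately show ?thesis by (simp only:)
        qed
      qed (use True bpos[of t] in auto)
      also have "\<dots> = ennreal (\<rho> ^ (n + 2) / (real n + 2) * ((1 + t) ^ n / sqrt (1 + t\<^sup>2) ^ (n + 2)))"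
        by (simp add: b_def power_divide mult.commute)
      also have "\<dots> = ennreal (\<rho> ^ (n + 2) / (real n + 2)) * ennreal ((1 + t) ^ n / sqrt (1 + t\<^sup>2) ^ (n + 2) * indicator {0..1} t)"
        using True assms by (subst ennreal_mult') (auto simp: indicator_def)
      finally show ?thesis .
    next
      case False
      with t show ?thesis by (auto simp: indicator_def)
    qed
    show "AE t in lborel. (\<integral>\<^sup>+x. ennreal (x ^ (n + 1) * (1 + t) ^ n) * indicator {0<..<b t} x * indicator {0<..<1} t \<partial>lborel)
      = ennreal (\<rho> ^ (n + 2) / (real n + 2)) * ennreal ((1 + t) ^ n / sqrt (1 + t\<^sup>2) ^ (n + 2) * indicator {0..1} t)"
      using AE_lborel_singleton[of 0] AE_lborel_singleton[of 1] by eventually_elim (rule main)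
  qed
  also have "\<dots> = ennreal (\<rho> ^ (n + 2) / (real n + 2)) *
      (\<integral>\<^sup>+t. ennreal ((1 + t) ^ n / sqrt (1 + t\<^sup>2) ^ (n + 2) * indicator {0..1} t) \<partial>lborel)"
    by (rule nn_integral_cmult) auto
  also have "(\<integral>\<^sup>+t. ennreal ((1 + t) ^ n / sqrt (1 + t\<^sup>2) ^ (n + 2) * indicator {0..1} t) \<partial>lborel)
    = (\<integral>\<^sup>+t. ennreal ((1 + t) ^ n / sqrt (1 + t\<^sup>2) ^ (n + 2) * indicator {tan 0..tan (pi/4)} t) \<partial>lborel)"
    by (simp add: tan_45)
  also have "\<dots> = (\<integral>\<^sup>+\<theta>. ennreal ((1 + tan \<theta>) ^ n / sqrt (1 + (tan \<theta>)\<^sup>2) ^ (n + 2) * inverse ((cos \<theta>)\<^sup>2) * indicator {0..pi/4} \<theta>) \<partial>lborel)"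
  proof (rule nn_integral_substitution)
    show "set_borel_measurable borel {tan 0..tan (pi/4)} (\<lambda>t. (1 + t) ^ n / sqrt (1 + t\<^sup>2) ^ (n + 2))"
      unfolding set_borel_measurable_def by measurable
    have c: "cos \<theta> > 0" if "\<theta> \<in> {0..pi/4}" for \<theta>
      using that by (rule cos_pos_quarter_pi)
    show "(tan has_real_derivative inverse ((cos \<theta>)\<^sup>2)) (at \<theta>)" if "\<theta> \<in> {0..pi/4}" for \<theta>
      using c[OF that] by (intro DERIV_tan) auto
    show "continuous_on {0..pi/4} (\<lambda>\<theta>. inverse ((cos \<theta>)\<^sup>2))"
      using c by (fastforce intro!: continuous_intros)
  qed auto
  also have "\<dots> = (\<integral>\<^sup>+\<theta>. ennreal ((cos \<theta> + sin \<theta>) ^ n) * indicator {0..pi/4} \<theta> \<partial>lborel)"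
  proof (rule nn_integral_cong)
    fix \<theta> :: real
    show "ennreal ((1 + tan \<theta>) ^ n / sqrt (1 + (tan \<theta>)\<^sup>2) ^ (n + 2) * inverse ((cos \<theta>)\<^sup>2) * indicator {0..pi/4} \<theta>)
      = ennreal ((cos \<theta> + sin \<theta>) ^ n) * indicator {0..pi/4} \<theta>"
    proof (cases "\<theta> \<in> {0..pi/4}")
      case True
      then have c: "cos \<theta> > 0" by (rule cos_pos_quarter_pi)
      have "1 + (tan \<theta>)\<^sup>2 = (1 / cos \<theta>)\<^sup>2"
        using c tan_sec[of \<theta>] by (simp add: inverse_eq_divide power_divide)
      then have "sqrt (1 + (tan \<theta>)\<^sup>2) = 1 / cos \<theta>"
        using c by (simp add: real_sqrt_unique)
      moreover have "1 + tan \<theta> = (cos \<theta> + sin \<theta>) / cos \<theta>"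
        using c by (simp add: tan_def field_simps)
      \<comment> \<open>With \<open>a = cos \<theta>\<close> the powers of the cosine cancel:
        \<open>n\<close> from \<open>1 + tan \<theta>\<close> and 2 from the derivative of the
        tangent, against \<open>n + 2\<close> from the square root.\<close>
      moreover have "(s / a) ^ n / (1 / a) ^ (n + 2) * inverse (a\<^sup>2) = s ^ n" if "a > 0" for s a :: real
        using that by (simp add: power_divide power_add field_simps power2_eq_square)
      ultimately have "(1 + tan \<theta>) ^ n / sqrt (1 + (tan \<theta>)\<^sup>2) ^ (n + 2) * inverse ((cos \<theta>)\<^sup>2) = (cos \<theta> + sin \<theta>) ^ n"
        using c by (simp only:)
      with True show ?thesis by simp
    qed simp
  qed
  finally show ?thesis .
qed

text \<open>Reflections in the axes and in the diagonal cut the disc into eight octants with equal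
  integrals. Each contributes \<open>\<rho> ^ (n + 2) / (n + 2) * (chi n 1 / 2)\<close>, which
  explains the factor 4.\<close>

lemma nn_integral_ball_power:
  assumes "\<rho> > 0"
  shows "(\<integral>\<^sup>+z. ennreal ((\<bar>Re z\<bar> + \<bar>Im z\<bar>) ^ n) * indicator (ball 0 \<rho>) z \<partial>lborel)
    = ennreal (4 * chi (real n) 1 * \<rho> ^ (n + 2) / (real n + 2))"
proof -
  define F :: "real \<Rightarrow> real \<Rightarrow> ennreal"
    where "F = (\<lambda>x y. if x\<^sup>2 + y\<^sup>2 < \<rho>\<^sup>2 then ennreal ((x + y) ^ n) else 0)"
  have Fsym: "F x y = F y x" for x y
    by (simp add: F_def add.commute)
  have Feq: "ennreal ((\<bar>Re z\<bar> + \<bar>Im z\<bar>) ^ n) * indicator (ball 0 \<rho>) z = F \<bar>Re z\<bar> \<bar>Im z\<bar>" for z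
  proof -
    have "cmod z < \<rho> \<longleftrightarrow> (Re z)\<^sup>2 + (Im z)\<^sup>2 < \<rho>\<^sup>2"
      using assms real_sqrt_less_iff[of "(Re z)\<^sup>2 + (Im z)\<^sup>2" "\<rho>\<^sup>2"] by (simp add: cmod_def)
    then show ?thesis by (simp add: F_def indicator_def)
  qed
  have FM [measurable]: "(\<lambda>x. F (f x) (g x)) \<in> borel_measurable M"
    if [measurable]: "f \<in> borel_measurable M" "g \<in> borel_measurable M" for f g M
    unfolding F_def by measurable
  \<comment> \<open>\<open>Q\<close> is \<open>F\<close> on the open quadrant and \<open>P\<close>
    is \<open>F\<close> on the octant below the diagonal. For fixed \<open>x\<close> they satisfy
    \<open>Q x y = P x y + P y x\<close> except at the null point \<open>y = x\<close>.\<close>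
  define Q where "Q = (\<lambda>x y. F x y * (indicator {0<..} y * indicator {0<..} x))"
  define P where "P = (\<lambda>x y. F x y * of_bool (0 < y \<and> y < x))"
  have PM [measurable]: "(\<lambda>x. P (f x) (g x)) \<in> borel_measurable M"
    if [measurable]: "f \<in> borel_measurable M" "g \<in> borel_measurable M" for f g M
    unfolding P_def by measurable
  have "(\<integral>\<^sup>+z. ennreal ((\<bar>Re z\<bar> + \<bar>Im z\<bar>) ^ n) * indicator (ball 0 \<rho>) z \<partial>lborel)
    = (\<integral>\<^sup>+x. \<integral>\<^sup>+y. F \<bar>x\<bar> \<bar>y\<bar> \<partial>lborel \<partial>lborel)"
    unfolding Feq by (subst nn_integral_lborel_complex) auto
  also have "\<dots> = (\<integral>\<^sup>+x. 2 * (\<integral>\<^sup>+y. F \<bar>x\<bar> y * indicator {0<..} y \<partial>lborel) \<partial>lborel)"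
    by (intro nn_integral_cong nn_integral_abs) measurable
  also have "\<dots> = 2 * (\<integral>\<^sup>+x. (2 * (\<integral>\<^sup>+y. F x y * indicator {0<..} y \<partial>lborel)) * indicator {0<..} x \<partial>lborel)"
    by (rule nn_integral_abs) measurable
  also have "\<dots> = 2 * (\<integral>\<^sup>+x. 2 * (\<integral>\<^sup>+y. Q x y \<partial>lborel) \<partial>lborel)"
  proof -
    have "2 * (\<integral>\<^sup>+y. F x y * indicator {0<..} y \<partial>lborel) * indicator {0<..} x = 2 * (\<integral>\<^sup>+y. Q x y \<partial>lborel)" for x
      unfolding Q_def by (auto simp: indicator_def intro!: nn_integral_cong)
    then show ?thesis by simp
  qed
  also have "\<dots> = 4 * (\<integral>\<^sup>+x. \<integral>\<^sup>+y. Q x y \<partial>lborel \<partial>lborel)"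
    by (subst nn_integral_cmult) (auto simp: Q_def simp flip: mult.assoc)
  also have "(\<integral>\<^sup>+x. \<integral>\<^sup>+y. Q x y \<partial>lborel \<partial>lborel) = (\<integral>\<^sup>+x. \<integral>\<^sup>+y. P x y + P y x \<partial>lborel \<partial>lborel)"
  proof (rule nn_integral_cong, rule nn_integral_cong_AE)
    fix x :: real
    show "AE y in lborel. Q x y = P x y + P y x"
      using AE_lborel_singleton[of x]
      by eventually_elim (auto simp: Q_def P_def indicator_def Fsym)
  qed
  also have "\<dots> = (\<integral>\<^sup>+x. \<integral>\<^sup>+y. P x y \<partial>lborel \<partial>lborel) + (\<integral>\<^sup>+x. \<integral>\<^sup>+y. P y x \<partial>lborel \<partial>lborel)"
    by (simp add: nn_integral_add)
  also have "(\<integral>\<^sup>+x. \<integral>\<^sup>+y. P y x \<partial>lborel \<partial>lborel) = (\<integral>\<^sup>+x. \<integral>\<^sup>+y. P x y \<partial>lborel \<partial>lborel)"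
    by (rule lborel_pair.Fubini') measurable
  also have "(\<integral>\<^sup>+x. \<integral>\<^sup>+y. P x y \<partial>lborel \<partial>lborel)
     = (\<integral>\<^sup>+x. \<integral>\<^sup>+y. ennreal ((x + y) ^ n) * indicator {y. x\<^sup>2 + y\<^sup>2 < \<rho>\<^sup>2 \<and> 0 < y \<and> y < x} y \<partial>lborel \<partial>lborel)"
    unfolding P_def F_def by (auto simp: indicator_def intro!: nn_integral_cong)
  also have "\<dots> = ennreal (\<rho> ^ (n + 2) / (real n + 2)) * ennreal (chi (real n) 1 / 2)"
    unfolding nn_integral_octant[OF assms] nn_integral_cos_plus_sin_power ..
  also have "4 * (\<dots> + \<dots>) = ennreal (4 * (\<rho> ^ (n + 2) / (real n + 2) * (chi (real n) 1 / 2) + \<rho> ^ (n + 2) / (real n + 2) * (chi (real n) 1 / 2)))"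
  proof -
    have "4 * (ennreal a * ennreal b + ennreal a * ennreal b) = ennreal (4 * (a * b + a * b))"
      if "a \<ge> 0" "b \<ge> 0" for a b
      using that by (simp flip: ennreal_mult ennreal_plus ennreal_numeral)
    then show ?thesis using assms chi_nonneg[of n] by simp
  qed
  also have "4 * (p / m * (q / 2) + p / m * (q / 2)) = 4 * q * p / m" for p q m :: real
    by simp
  finally show ?thesis .
qed

section \<open>The intensity measures\<close>

text \<open>Passing to Cartesian coordinates makes measurability evident and exposes a power of
  \<open>\<bar>Re z\<bar> + \<bar>Im z\<bar>\<close>. The value of \<open>Arg\<close> at the origin
  is immaterial, since the angle enters only multiplied by \<open>cmod z\<close>.\<close>

lemma wall_prob_Arg:
  "wall_prob lw N (cmod z) (Arg z)
    = (lw * (\<bar>Re z\<bar> + \<bar>Im z\<bar>)) ^ N / fact N * exp (- (lw * (\<bar>Re z\<bar> + \<bar>Im z\<bar>)))"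
proof -
  have "z = rcis (cmod z) (Arg z)" by (simp add: rcis_cmod_Arg)
  then have "Re z = cmod z * cos (Arg z)" "Im z = cmod z * sin (Arg z)"
    by (metis Re_rcis, metis Im_rcis)
  then have "lw * cmod z * \<bar>cos (Arg z)\<bar> + lw * cmod z * \<bar>sin (Arg z)\<bar> = lw * (\<bar>Re z\<bar> + \<bar>Im z\<bar>)"
    by (simp add: abs_mult distrib_left)
  then show ?thesis by (simp add: wall_prob_def)
qed

text \<open>This is a Poisson probability: \<open>x ^ N / fact N\<close> is a single term of the
  nonnegative series of \<open>exp x\<close>.\<close>

lemma wall_prob_bounds:
  assumes "lw > 0"
  shows "0 \<le> wall_prob lw N (cmod z) (Arg z)" "wall_prob lw N (cmod z) (Arg z) \<le> 1"
proof -
  define x where "x = lw * (\<bar>Re z\<bar> + \<bar>Im z\<bar>)"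
  have x: "x \<ge> 0" using assms by (simp add: x_def)
  have "x ^ N / fact N \<le> (\<Sum>k. x ^ k / fact k)"
  proof -
    have s: "summable (\<lambda>k. x ^ k / fact k)"
      using summable_exp[of x] by (simp add: field_simps)
    have "(\<Sum>k\<in>{N}. x ^ k / fact k) \<le> (\<Sum>k. x ^ k / fact k)"
      by (rule sum_le_suminf[OF s]) (use x in auto)
    then show ?thesis by simp
  qed
  also have "\<dots> = exp x" by (simp add: exp_def divide_inverse mult.commute)
  finally have "x ^ N / fact N * exp (- x) \<le> exp x * exp (- x)"
    by (intro mult_right_mono) auto
  then show "wall_prob lw N (cmod z) (Arg z) \<le> 1"
    unfolding wall_prob_Arg x_def[symmetric] by (simp flip: exp_add)
  show "0 \<le> wall_prob lw N (cmod z) (Arg z)"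
    unfolding wall_prob_Arg x_def[symmetric] using x by simp
qed

lemma wall_prob_measurable [measurable]:
  "(\<lambda>z. wall_prob lw N (cmod z) (Arg z)) \<in> borel_measurable borel"
  unfolding wall_prob_Arg by measurable

lemma space_ph_intensity [simp]: "space (ph_intensity lPH lw R N) = cball 0 R"
  by (simp add: ph_intensity_def space_restrict_space)

lemma sets_ph_intensity: "B \<in> sets (ph_intensity lPH lw R N) \<longleftrightarrow> B \<in> sets borel \<and> B \<subseteq> cball 0 R"
  by (auto simp: ph_intensity_def sets_restrict_space_iff)

lemma emeasure_ph_intensity:
  assumes "B \<in> sets borel" "B \<subseteq> cball 0 R"
  shows "emeasure (ph_intensity lPH lw R N) B
    = (\<integral>\<^sup>+z. ennreal (lPH * wall_prob lw N (cmod z) (Arg z)) * indicator B z \<partial>lborel)"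
proof -
  have B: "B \<in> sets (restrict_space lborel (cball 0 R))"
    using assms by (simp add: sets_restrict_space_iff)
  have "emeasure (ph_intensity lPH lw R N) B
    = (\<integral>\<^sup>+z. ennreal (lPH * wall_prob lw N (cmod z) (Arg z)) * indicator B z \<partial>restrict_space lborel (cball 0 R))"
    unfolding ph_intensity_def
    by (intro emeasure_density B measurable_restrict_space1) measurable
  also have "\<dots> = (\<integral>\<^sup>+z. (ennreal (lPH * wall_prob lw N (cmod z) (Arg z)) * indicator B z) * indicator (cball 0 R) z \<partial>lborel)"
    by (rule nn_integral_restrict_space) auto
  also have "\<dots> = (\<integral>\<^sup>+z. ennreal (lPH * wall_prob lw N (cmod z) (Arg z)) * indicator B z \<partial>lborel)"
    using assms(2) by (intro nn_integral_cong) (auto simp: indicator_def)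
  finally show ?thesis .
qed

text \<open>Bounding the density by \<open>lPH\<close> makes the intensities of all \<open>N\<close> summable and
  continuous in the radius simultaneously.\<close>

lemma emeasure_ph_intensity_le:
  assumes "lw > 0" "lPH > 0" "B \<in> sets borel" "B \<subseteq> cball 0 R"
  shows "emeasure (ph_intensity lPH lw R N) B \<le> ennreal lPH * emeasure lborel B"
proof -
  have "emeasure (ph_intensity lPH lw R N) B \<le> (\<integral>\<^sup>+z. ennreal lPH * indicator B z \<partial>lborel)"
    unfolding emeasure_ph_intensity[OF assms(3,4)]
    using wall_prob_bounds[OF assms(1)] assms(2)
    by (intro nn_integral_mono mult_right_mono ennreal_leI) (auto simp: mult_le_cancel_left1)
  also have "\<dots> = ennreal lPH * emeasure lborel B"
    using assms(3) by (simp add: nn_integral_cmult_indicator)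
  finally show ?thesis .
qed

text \<open>Circles are null sets, so the boundary does not matter. The slack in \<open>B\<close> is
  needed because the points of small loss form an open ball when its radius is at most
  \<open>R\<close>, but the closed disc of radius \<open>R\<close> when the radius exceeds
  \<open>R\<close>.\<close>

lemma emeasure_ph_intensity_ball_cball:
  assumes "B \<in> sets borel" "B \<subseteq> cball 0 R" "ball 0 \<rho> \<subseteq> B" "B \<subseteq> cball 0 \<rho>"
  shows "emeasure (ph_intensity lPH lw R N) B
    = (\<integral>\<^sup>+z. ennreal (lPH * wall_prob lw N (cmod z) (Arg z)) * indicator (ball 0 \<rho>) z \<partial>lborel)"
proof -
  have "sphere (0::complex) \<rho> \<in> null_sets lborel"
    using negligible_sphere[of "0::complex" \<rho>]
    by (auto simp: null_sets_completion_iff negligible_iff_null_sets)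
  then have "AE z in lborel. z \<notin> sphere (0::complex) \<rho>"
    by (rule AE_not_in)
  then have "AE z in lborel. ennreal (lPH * wall_prob lw N (cmod z) (Arg z)) * indicator B z
      = ennreal (lPH * wall_prob lw N (cmod z) (Arg z)) * indicator (ball 0 \<rho>) z"
  proof eventually_elim
    case (elim z)
    then have "z \<in> B \<longleftrightarrow> z \<in> ball 0 \<rho>"
      using assms(3,4) by (auto simp: subset_iff less_le)
    then show ?case by (simp add: indicator_def)
  qed
  then show ?thesis
    unfolding emeasure_ph_intensity[OF assms(1,2)] by (rule nn_integral_cong_AE)
qed

text \<open>Expand \<open>exp (- (lw * s))\<close> in the density and integrate each power of
  \<open>s\<close> over the disc. The series alternates, so monotone convergence does not apply;
  instead the integrals of the absolute values are summable, because
  \<open>s \<le> 2 * \<rho>\<close> on the disc bounds them by a multiple of the exponential series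
  at \<open>lw * (2 * \<rho>)\<close>.\<close>

lemma ph_intensity_sums:
  assumes "lw > 0" "lPH > 0" "\<rho> > 0"
    and B: "B \<in> sets borel" "B \<subseteq> cball 0 R" "ball 0 \<rho> \<subseteq> B" "B \<subseteq> cball 0 \<rho>"
  shows "(\<lambda>j. 4 * lPH / fact N * ((-1) ^ j * chi (real (j + N)) lw / (fact j * (real (j + N) + 2)) * \<rho> ^ (j + N + 2)))
    sums measure (ph_intensity lPH lw R N) B"
proof -
  define s where "s = (\<lambda>z. \<bar>Re z\<bar> + \<bar>Im z\<bar>)"
  define D where "D = ball (0::complex) \<rho>"
  have s0: "s z \<ge> 0" for z by (simp add: s_def)
  have [measurable]: "s \<in> borel_measurable borel" unfolding s_def by measurable
  have [measurable]: "D \<in> sets borel" unfolding D_def by simp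
  have s_le: "s z \<le> 2 * \<rho>" if "z \<in> D" for z
    using that abs_Re_le_cmod[of z] abs_Im_le_cmod[of z] by (simp add: s_def D_def)
  \<comment> \<open>The coefficient of \<open>s z ^ (j + N)\<close> in the expanded density.\<close>
  define c where "c = (\<lambda>j::nat. lPH / fact N * ((-1) ^ j / fact j) * lw ^ (j + N))"
  have pw: "has_bochner_integral lborel (\<lambda>z. s z ^ n * indicator D z) (4 * chi (real n) 1 * \<rho> ^ (n + 2) / (real n + 2))" for n
  proof (rule has_bochner_integral_nn_integral)
    show "(\<integral>\<^sup>+z. ennreal (s z ^ n * indicator D z) \<partial>lborel) = ennreal (4 * chi (real n) 1 * \<rho> ^ (n + 2) / (real n + 2))"
      unfolding nn_integral_ball_power[OF assms(3), symmetric] s_def D_def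
      by (intro nn_integral_cong) (auto simp: indicator_def)
  qed (use s0 chi_nonneg[of n] assms in auto)
  define f where "f = (\<lambda>j z. c j * (s z ^ (j + N) * indicator D z))"
  have fint: "has_bochner_integral lborel (f j) (c j * (4 * chi (real (j + N)) 1 * \<rho> ^ (j + N + 2) / (real (j + N) + 2)))" for j
    unfolding f_def using pw[of "j + N"] by (rule has_bochner_integral_mult_right)
  have fsum: "(\<lambda>j. f j z) sums (lPH * wall_prob lw N (cmod z) (Arg z) * indicator D z)" for z
  proof -
    have "(\<lambda>j. (- (lw * s z)) ^ j /\<^sub>R fact j) sums exp (- (lw * s z))"
      by (rule exp_converges)
    then have "(\<lambda>j. lPH * ((lw * s z) ^ N / fact N) * indicator D z * ((- (lw * s z)) ^ j /\<^sub>R fact j)) sums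
       (lPH * ((lw * s z) ^ N / fact N) * indicator D z * exp (- (lw * s z)))"
      by (rule sums_mult)
    moreover have "lPH * ((lw * s z) ^ N / fact N) * indicator D z * ((- (lw * s z)) ^ j /\<^sub>R fact j) = f j z" for j
      unfolding f_def c_def power_minus[of "lw * s z"]
      by (simp add: power_add power_mult_distrib field_simps)
    ultimately have "(\<lambda>j. f j z) sums (lPH * ((lw * s z) ^ N / fact N) * indicator D z * exp (- (lw * s z)))"
      by (simp only:)
    then show ?thesis
      by (simp only: wall_prob_Arg s_def mult_ac)
  qed
  have fabs: "summable (\<lambda>j. \<bar>f j z\<bar>)" for z
  proof -
    have "(\<lambda>j. lPH * ((lw * s z) ^ N / fact N) * indicator D z * ((lw * s z) ^ j /\<^sub>R fact j)) sums
       (lPH * ((lw * s z) ^ N / fact N) * indicator D z * exp (lw * s z))"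
      by (rule sums_mult[OF exp_converges])
    moreover have "lPH * ((lw * s z) ^ N / fact N) * indicator D z * ((lw * s z) ^ j /\<^sub>R fact j) = \<bar>f j z\<bar>" for j
      unfolding f_def c_def using assms(1,2) s0[of z]
      by (simp add: abs_mult power_abs power_add power_mult_distrib field_simps)
    ultimately show ?thesis by (auto dest: sums_summable)
  qed
  have nsum: "summable (\<lambda>j. \<integral>z. norm (f j z) \<partial>lborel)"
  proof (rule summable_comparison_test')
    define A where "A = measure lborel D"
    have Dfin: "emeasure lborel D < \<infinity>" unfolding D_def by (rule emeasure_bounded_finite) simp
    have "summable (\<lambda>j. lPH / fact N * (lw * (2 * \<rho>)) ^ N * A * (inverse (fact j) * (lw * (2 * \<rho>)) ^ j))"
      by (intro summable_mult summable_exp)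
    then show "summable (\<lambda>j. \<bar>c j\<bar> * (2 * \<rho>) ^ (j + N) * A)"
      using assms(1,2) by (simp add: c_def abs_mult power_abs power_add power_mult_distrib field_simps)
    show "norm (\<integral>z. norm (f j z) \<partial>lborel) \<le> \<bar>c j\<bar> * (2 * \<rho>) ^ (j + N) * A" for j
    proof -
      have "(\<integral>z. norm (f j z) \<partial>lborel) \<le> (\<integral>z. (\<bar>c j\<bar> * (2 * \<rho>) ^ (j + N)) * indicator D z \<partial>lborel)"
      proof (rule integral_mono)
        show "integrable lborel (\<lambda>z. norm (f j z))"
          using fint[of j] by (intro integrable_norm) (simp add: has_bochner_integral_iff)
        show "integrable lborel (\<lambda>z. (\<bar>c j\<bar> * (2 * \<rho>) ^ (j + N)) * indicator D z)"
          using Dfin by (intro integrable_mult_right integrable_real_indicator) auto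
        show "norm (f j z) \<le> (\<bar>c j\<bar> * (2 * \<rho>) ^ (j + N)) * indicator D z" for z
          using power_mono[OF s_le[of z] s0[of z], of "j + N"] s0[of z]
          by (auto simp: f_def abs_mult power_abs indicator_def intro!: mult_left_mono power_mono)
      qed
      also have "\<dots> = \<bar>c j\<bar> * (2 * \<rho>) ^ (j + N) * A"
        by (simp add: A_def)
      finally show ?thesis by simp
    qed
  qed
  have "(\<lambda>j. integral\<^sup>L lborel (f j)) sums (\<integral>z. (\<Sum>j. f j z) \<partial>lborel)"
    using fint fabs nsum by (intro sums_integral) (auto simp: has_bochner_integral_iff)
  moreover have "integrable lborel (\<lambda>z. \<Sum>j. f j z)"
    using fint fabs nsum by (intro integrable_suminf) (auto simp: has_bochner_integral_iff)
  moreover have "(\<Sum>j. f j z) = lPH * wall_prob lw N (cmod z) (Arg z) * indicator D z" for z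
    using fsum by (rule sums_unique[symmetric])
  ultimately have S: "(\<lambda>j. integral\<^sup>L lborel (f j)) sums (\<integral>z. lPH * wall_prob lw N (cmod z) (Arg z) * indicator D z \<partial>lborel)"
    and I: "integrable lborel (\<lambda>z. lPH * wall_prob lw N (cmod z) (Arg z) * indicator D z)"
    by simp_all
  have nn: "lPH * wall_prob lw N (cmod z) (Arg z) * indicator D z \<ge> 0" for z
    using wall_prob_bounds[OF assms(1)] assms(2) by simp
  \<comment> \<open>The measure is a nonnegative integral while the series was integrated as a
    signed one; integrability and nonnegativity of the density identify the two values.\<close>
  have "emeasure (ph_intensity lPH lw R N) B
    = (\<integral>\<^sup>+z. ennreal (lPH * wall_prob lw N (cmod z) (Arg z) * indicator D z) \<partial>lborel)"
    unfolding emeasure_ph_intensity_ball_cball[OF B] D_def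
    by (intro nn_integral_cong) (auto simp: indicator_def)
  also have "\<dots> = ennreal (\<integral>z. lPH * wall_prob lw N (cmod z) (Arg z) * indicator D z \<partial>lborel)"
    using I nn by (intro nn_integral_eq_integral) auto
  finally have "measure (ph_intensity lPH lw R N) B = (\<integral>z. lPH * wall_prob lw N (cmod z) (Arg z) * indicator D z \<partial>lborel)"
    using nn by (simp add: measure_def)
  moreover have "integral\<^sup>L lborel (f j) = 4 * lPH / fact N * ((-1) ^ j * chi (real (j + N)) lw / (fact j * (real (j + N) + 2)) * \<rho> ^ (j + N + 2))" for j
  proof -
    have "integral\<^sup>L lborel (f j) = c j * (4 * chi (real (j + N)) 1 * \<rho> ^ (j + N + 2) / (real (j + N) + 2))"
      using fint by (simp add: has_bochner_integral_iff)
    then show ?thesis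
      unfolding c_def chi_eq_power_mult[OF assms(1), of "j + N"] by (simp add: mult_ac)
  qed
  ultimately show ?thesis using S by simp
qed

section \<open>Regions of small loss and the closed form of their intensity\<close>

definition loss_region :: "real \<Rightarrow> real \<Rightarrow> real \<Rightarrow> real \<Rightarrow> nat \<Rightarrow> real \<Rightarrow> complex set" where
  "loss_region \<kappa> \<beta> K R N \<alpha> = {z \<in> cball 0 R. path_loss \<kappa> \<beta> K N (cmod z) < \<alpha>}"

text \<open>For positive parameters, the solution \<open>r\<close> of
  \<open>path_loss \<kappa> \<beta> K N r = \<alpha>\<close>.\<close>

definition loss_radius :: "real \<Rightarrow> real \<Rightarrow> real \<Rightarrow> nat \<Rightarrow> real \<Rightarrow> real" where
  "loss_radius \<kappa> \<beta> K N \<alpha> = (\<alpha> * K ^ N / \<kappa>) powr (1 / \<beta>)"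

lemma loss_region_borel [measurable]: "loss_region \<kappa> \<beta> K R N \<alpha> \<in> sets borel"
proof -
  have "Measurable.pred borel (\<lambda>z::complex. cmod z \<le> R \<and> path_loss \<kappa> \<beta> K N (cmod z) < \<alpha>)"
    unfolding path_loss_def by measurable
  then show ?thesis
    by (simp add: loss_region_def pred_def cball_def)
qed

lemma loss_region_subset_cball: "loss_region \<kappa> \<beta> K R N \<alpha> \<subseteq> cball 0 R"
  by (auto simp: loss_region_def)

lemma path_loss_nonneg: "\<lbrakk>\<kappa> > 0; K > 0\<rbrakk> \<Longrightarrow> 0 \<le> path_loss \<kappa> \<beta> K N r"
  by (simp add: path_loss_def)

lemma less_powr_inverse_iff:
  fixes r y \<beta> :: real
  assumes "\<beta> > 0" "r \<ge> 0" "y > 0"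
  shows "r < y powr (1 / \<beta>) \<longleftrightarrow> r powr \<beta> < y"
proof -
  have y: "(y powr (1 / \<beta>)) powr \<beta> = y" using assms by (simp add: powr_powr)
  show ?thesis
  proof
    assume "r < y powr (1 / \<beta>)"
    then have "r powr \<beta> < (y powr (1 / \<beta>)) powr \<beta>"
      using assms by (intro powr_less_mono2) auto
    then show "r powr \<beta> < y" unfolding y .
  next
    assume "r powr \<beta> < y"
    show "r < y powr (1 / \<beta>)"
    proof (rule ccontr)
      assume "\<not> r < y powr (1 / \<beta>)"
      then have "(y powr (1 / \<beta>)) powr \<beta> \<le> r powr \<beta>"
        using assms by (intro powr_mono2) auto
      with \<open>r powr \<beta> < y\<close> show False unfolding y by simp
    qed
  qed
qed

lemma path_loss_less_iff:
  assumes "\<beta> > 0" "\<kappa> > 0" "K > 0" "r \<ge> 0" "\<alpha> > 0"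
  shows "path_loss \<kappa> \<beta> K N r < \<alpha> \<longleftrightarrow> r < loss_radius \<kappa> \<beta> K N \<alpha>"
  unfolding loss_radius_def path_loss_def
  using assms by (subst less_powr_inverse_iff) (auto simp: field_simps)

lemma loss_radius_pos: "\<lbrakk>\<kappa> > 0; K > 0; \<alpha> > 0\<rbrakk> \<Longrightarrow> loss_radius \<kappa> \<beta> K N \<alpha> > 0"
  by (simp add: loss_radius_def)

lemma loss_region_between:
  assumes "\<beta> > 0" "\<kappa> > 0" "K > 0" "R > 0" "\<alpha> > 0"
  shows "ball 0 (min (loss_radius \<kappa> \<beta> K N \<alpha>) R) \<subseteq> loss_region \<kappa> \<beta> K R N \<alpha>"
    and "loss_region \<kappa> \<beta> K R N \<alpha> \<subseteq> cball 0 (min (loss_radius \<kappa> \<beta> K N \<alpha>) R)"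
  using assms by (auto simp: loss_region_def path_loss_less_iff)

text \<open>The last factor of \<open>Lambda_term\<close> is in both cases a power of the radius
  \<open>min (loss_radius \<kappa> \<beta> K N \<alpha>) R\<close>, so the closed form is the series
  of \<open>ph_intensity_sums\<close> for that disc. Summability is stated separately because
  \<open>suminf\<close> has a value even for a divergent series.\<close>

lemma
  assumes "lw > 0" "lPH > 0" "\<beta> > 0" "\<kappa> > 0" "K > 0" "R > 0" "\<alpha> > 0"
  shows summable_Lambda_term: "summable (\<lambda>j. Lambda_term lw \<kappa> \<beta> K R N \<alpha> (j + N))"
    and Lambda_eq_measure:
      "Lambda lPH lw \<kappa> \<beta> K R N \<alpha> = measure (ph_intensity lPH lw R N) (loss_region \<kappa> \<beta> K R N \<alpha>)"
proof -
  define \<rho> where "\<rho> = min (loss_radius \<kappa> \<beta> K N \<alpha>) R"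
  have pos: "\<rho> > 0" using assms loss_radius_pos by (simp add: \<rho>_def)
  \<comment> \<open>The case condition of \<open>Lambda_term\<close> compares
    \<open>\<alpha>\<close> with the loss at distance \<open>R\<close>; by monotonicity of the loss
    this compares the two radii.\<close>
  have iff: "\<alpha> < R powr \<beta> * \<kappa> / K ^ N \<longleftrightarrow> loss_radius \<kappa> \<beta> K N \<alpha> < R"
  proof -
    have "\<alpha> = (loss_radius \<kappa> \<beta> K N \<alpha>) powr \<beta> * \<kappa> / K ^ N"
      using assms by (simp add: loss_radius_def powr_powr)
    then have "\<alpha> < R powr \<beta> * \<kappa> / K ^ N \<longleftrightarrow> (loss_radius \<kappa> \<beta> K N \<alpha>) powr \<beta> < R powr \<beta>"
      using assms by (smt (verit) divide_less_cancel mult_less_cancel_right zero_less_power)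
    also have "\<dots> \<longleftrightarrow> loss_radius \<kappa> \<beta> K N \<alpha> < (R powr \<beta>) powr (1 / \<beta>)"
      using assms by (intro less_powr_inverse_iff[symmetric]) (auto simp: loss_radius_def)
    also have "(R powr \<beta>) powr (1 / \<beta>) = R"
      using assms by (simp add: powr_powr)
    finally show ?thesis .
  qed
  have pw: "(if \<alpha> < R powr \<beta> * \<kappa> / K ^ N
      then (\<alpha> * K ^ N / \<kappa>) powr ((real n + 2) / \<beta>) else R ^ (n + 2)) = \<rho> ^ (n + 2)" for n
  proof (cases "loss_radius \<kappa> \<beta> K N \<alpha> < R")
    case True
    have "(\<alpha> * K ^ N / \<kappa>) powr ((real n + 2) / \<beta>) = loss_radius \<kappa> \<beta> K N \<alpha> powr (real (n + 2))"
      by (simp add: loss_radius_def powr_powr add.commute)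
    also have "\<dots> = loss_radius \<kappa> \<beta> K N \<alpha> ^ (n + 2)"
      using assms loss_radius_pos by (intro powr_realpow) auto
    finally show ?thesis using True iff by (simp add: \<rho>_def)
  next
    case False
    then show ?thesis using iff by (simp add: \<rho>_def)
  qed
  have T: "Lambda_term lw \<kappa> \<beta> K R N \<alpha> (j + N) =
      (-1) ^ j * chi (real (j + N)) lw / (fact j * (real (j + N) + 2)) * \<rho> ^ (j + N + 2)" for j
    unfolding Lambda_term_def pw by simp
  have S: "(\<lambda>j. 4 * lPH / fact N * Lambda_term lw \<kappa> \<beta> K R N \<alpha> (j + N))
    sums measure (ph_intensity lPH lw R N) (loss_region \<kappa> \<beta> K R N \<alpha>)"
    unfolding T using assms pos loss_region_between[of \<beta> \<kappa> K R \<alpha> N]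
    by (intro ph_intensity_sums) (auto simp: \<rho>_def loss_region_subset_cball)
  then have "summable (\<lambda>j. 4 * lPH / fact N * Lambda_term lw \<kappa> \<beta> K R N \<alpha> (j + N))"
    by (rule sums_summable)
  then show *: "summable (\<lambda>j. Lambda_term lw \<kappa> \<beta> K R N \<alpha> (j + N))"
    using assms by (subst (asm) summable_cmult_iff) auto
  show "Lambda lPH lw \<kappa> \<beta> K R N \<alpha> = measure (ph_intensity lPH lw R N) (loss_region \<kappa> \<beta> K R N \<alpha>)"
    unfolding Lambda_def suminf_mult[OF *, symmetric] using S by (rule sums_unique[symmetric])
qed

section \<open>Area bounds on the intensities\<close>

lemma emeasure_complex_ball:
  "r \<ge> 0 \<Longrightarrow> emeasure lborel (ball (0::complex) r) = ennreal (pi * r\<^sup>2)"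
  by (simp add: emeasure_ball unit_ball_vol_2)

lemma finite_measure_ph_intensity:
  assumes "lw > 0" "lPH > 0"
  shows "finite_measure (ph_intensity lPH lw R N)"
proof
  have "emeasure (ph_intensity lPH lw R N) (cball 0 R) \<le> ennreal lPH * emeasure lborel (cball (0::complex) R)"
    using assms by (intro emeasure_ph_intensity_le) auto
  also have "\<dots> < \<infinity>"
    using emeasure_bounded_finite[of "cball (0::complex) R"] by (simp add: ennreal_mult_less_top)
  finally show "emeasure (ph_intensity lPH lw R N) (space (ph_intensity lPH lw R N)) \<noteq> \<infinity>"
    by simp
qed

lemma measure_ph_intensity_le:
  assumes "lw > 0" "lPH > 0" "B \<in> sets borel" "B \<subseteq> cball 0 R"
    and "emeasure lborel B \<le> ennreal a" "a \<ge> 0"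
  shows "measure (ph_intensity lPH lw R N) B \<le> lPH * a"
proof -
  have "emeasure (ph_intensity lPH lw R N) B \<le> ennreal lPH * emeasure lborel B"
    using assms by (intro emeasure_ph_intensity_le)
  also have "\<dots> \<le> ennreal lPH * ennreal a"
    using assms by (intro mult_left_mono) auto
  also have "\<dots> = ennreal (lPH * a)"
    using assms by (simp add: ennreal_mult)
  finally show ?thesis
    using assms by (simp add: measure_def enn2real_leI)
qed

lemma Lambda_nonneg:
  assumes "lw > 0" "lPH > 0" "\<beta> > 0" "\<kappa> > 0" "K > 0" "R > 0" "\<alpha> > 0"
  shows "0 \<le> Lambda lPH lw \<kappa> \<beta> K R N \<alpha>"
  by (simp add: Lambda_eq_measure[OF assms])

text \<open>The density is at most \<open>lPH\<close>, and the region lies in a disc of radius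
  \<open>loss_radius\<close>. Leaving \<open>R\<close> out keeps a bound that decays geometrically
  in \<open>N\<close> when \<open>K < 1\<close>, which gives summability over all
  \<open>N\<close>.\<close>

lemma Lambda_le:
  assumes "lw > 0" "lPH > 0" "\<beta> > 0" "\<kappa> > 0" "K > 0" "R > 0" "\<alpha> > 0"
  shows "Lambda lPH lw \<kappa> \<beta> K R N \<alpha> \<le> lPH * (pi * (loss_radius \<kappa> \<beta> K N \<alpha>)\<^sup>2)"
  unfolding Lambda_eq_measure[OF assms]
proof (rule measure_ph_intensity_le[OF assms(1,2) loss_region_borel loss_region_subset_cball])
  have "loss_region \<kappa> \<beta> K R N \<alpha> \<subseteq> ball 0 (loss_radius \<kappa> \<beta> K N \<alpha>)"
    using assms by (auto simp: loss_region_def path_loss_less_iff)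
  then have "emeasure lborel (loss_region \<kappa> \<beta> K R N \<alpha>) \<le> emeasure lborel (ball (0::complex) (loss_radius \<kappa> \<beta> K N \<alpha>))"
    by (rule emeasure_mono) simp
  then show "emeasure lborel (loss_region \<kappa> \<beta> K R N \<alpha>) \<le> ennreal (pi * (loss_radius \<kappa> \<beta> K N \<alpha>)\<^sup>2)"
    using loss_radius_pos[OF assms(4,5,7), of \<beta> N] by (simp add: emeasure_complex_ball)
qed simp

text \<open>The points added when \<open>\<alpha>\<close> grows to \<open>\<alpha>'\<close> lie in
  the annulus between the two loss radii, so their intensity is at most \<open>lPH\<close> times its
  area.\<close>

lemma Lambda_increment_le:
  assumes "lw > 0" "lPH > 0" "\<beta> > 0" "\<kappa> > 0" "K > 0" "R > 0" "\<alpha> > 0" "\<alpha> \<le> \<alpha>'"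
  shows "Lambda lPH lw \<kappa> \<beta> K R N \<alpha>' \<le> Lambda lPH lw \<kappa> \<beta> K R N \<alpha>
    + lPH * (pi * ((loss_radius \<kappa> \<beta> K N \<alpha>')\<^sup>2 - (loss_radius \<kappa> \<beta> K N \<alpha>)\<^sup>2))"
proof -
  let ?\<mu> = "ph_intensity lPH lw R N"
  define r r' where "r = loss_radius \<kappa> \<beta> K N \<alpha>" and "r' = loss_radius \<kappa> \<beta> K N \<alpha>'"
  have \<alpha>': "\<alpha>' > 0" using assms by simp
  have r: "r > 0" using loss_radius_pos[OF assms(4,5,7)] by (simp add: r_def)
  have rr: "r \<le> r'"
    using assms unfolding r_def r'_def loss_radius_def
    by (intro powr_mono2 divide_right_mono mult_right_mono) auto
  interpret finite_measure ?\<mu> by (rule finite_measure_ph_intensity[OF assms(1,2)])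
  let ?B = "loss_region \<kappa> \<beta> K R N \<alpha>" and ?B' = "loss_region \<kappa> \<beta> K R N \<alpha>'"
  have sub: "?B \<subseteq> ?B'" using assms by (auto simp: loss_region_def)
  have S: "?B \<in> sets ?\<mu>" "?B' \<in> sets ?\<mu>"
    by (simp_all add: sets_ph_intensity loss_region_subset_cball)
  have "measure ?\<mu> (?B' - ?B) \<le> lPH * (pi * (r'\<^sup>2 - r\<^sup>2))"
  proof (rule measure_ph_intensity_le[OF assms(1,2)])
    have "?B' - ?B \<subseteq> ball 0 r' - ball 0 r"
      using assms \<alpha>' by (auto simp: loss_region_def path_loss_less_iff r_def r'_def)
    then have "emeasure lborel (?B' - ?B) \<le> emeasure lborel (ball (0::complex) r' - ball 0 r)"
      by (rule emeasure_mono) simp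
    also have "\<dots> = emeasure lborel (ball (0::complex) r') - emeasure lborel (ball (0::complex) r)"
      using rr by (intro emeasure_Diff) (auto simp: subset_ball emeasure_complex_ball r less_imp_le)
    also have "\<dots> = ennreal (pi * (r'\<^sup>2 - r\<^sup>2))"
      using r rr by (simp add: emeasure_complex_ball right_diff_distrib flip: ennreal_minus)
    finally show "emeasure lborel (?B' - ?B) \<le> ennreal (pi * (r'\<^sup>2 - r\<^sup>2))" .
    show "0 \<le> pi * (r'\<^sup>2 - r\<^sup>2)" using r rr by (simp add: power_mono)
    show "?B' - ?B \<subseteq> cball 0 R" by (auto simp: loss_region_def)
  qed simp
  moreover have "measure ?\<mu> (?B' - ?B) = measure ?\<mu> ?B' - measure ?\<mu> ?B"
    using S sub by (intro finite_measure_Diff)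
  ultimately show ?thesis
    using Lambda_eq_measure[OF assms(1-7)] Lambda_eq_measure[OF assms(1-6) \<alpha>']
    by (simp add: r_def r'_def)
qed

text \<open>Separates the dependence on \<open>\<alpha>\<close> from that on \<open>N\<close>, which
  is geometric with ratio \<open>K powr (2 / \<beta>)\<close>. One factor in \<open>\<alpha>\<close>
  thus controls all \<open>N\<close> at once.\<close>

lemma loss_radius_squared:
  assumes "\<kappa> > 0" "K > 0" "\<alpha> > 0"
  shows "(loss_radius \<kappa> \<beta> K N \<alpha>)\<^sup>2 = \<alpha> powr (2 / \<beta>) * (\<kappa> powr (- 2 / \<beta>) * (K powr (2 / \<beta>)) ^ N)"
proof -
  have "(loss_radius \<kappa> \<beta> K N \<alpha>)\<^sup>2 = (\<alpha> * K ^ N / \<kappa>) powr (2 / \<beta>)"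
    using assms by (simp add: loss_radius_def powr_powr flip: powr_numeral)
  also have "\<dots> = \<alpha> powr (2 / \<beta>) * (K ^ N) powr (2 / \<beta>) / \<kappa> powr (2 / \<beta>)"
    using assms by (simp add: powr_divide powr_mult)
  also have "(K ^ N) powr (2 / \<beta>) = (K powr (2 / \<beta>)) ^ N"
    using assms by (simp add: powr_powr mult.commute flip: powr_realpow)
  finally show ?thesis
    using assms by (simp add: powr_minus divide_inverse)
qed

section \<open>Void probabilities\<close>

lemma count_in_measurable [measurable]:
  assumes "B \<in> sets S"
  shows "count_in B \<in> measurable (configurations S) (count_space UNIV)"
proof -
  let ?G = "{{X. set_mset X \<subseteq> space S \<and> count_in B X = k} | B k. B \<in> sets S}"
  have G: "?G \<subseteq> Pow {X. set_mset X \<subseteq> space S}" by auto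
  have sp: "space (configurations S) = {X. set_mset X \<subseteq> space S}"
    unfolding configurations_def by (rule space_measure_of[OF G])
  have "count_in B -` {k} \<inter> space (configurations S) \<in> sets (configurations S)" for k
  proof -
    have "count_in B -` {k} \<inter> space (configurations S) = {X. set_mset X \<subseteq> space S \<and> count_in B X = k}"
      unfolding sp by auto
    also have "\<dots> \<in> sets (configurations S)"
      unfolding configurations_def sets_measure_of[OF G] using assms by blast
    finally show ?thesis .
  qed
  then show ?thesis
    by (simp add: measurable_count_space_eq2_countable)
qed

lemma space_configurations: "space (configurations S) = {X. set_mset X \<subseteq> space S}"
  unfolding configurations_def by (rule space_measure_of) auto

lemma count_in_eq_0_iff: "count_in B X = 0 \<longleftrightarrow> (\<forall>x\<in>#X. x \<notin> B)"
  by (auto simp: count_in_def simp flip: set_mset_eq_empty_iff)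

text \<open>The mean of the Poisson law: term \<open>k + 1\<close> is \<open>m\<close> times weight
  \<open>k\<close>, and term 0 vanishes. The rate 0 is covered.\<close>

lemma poisson_weights_sums:
  "(\<lambda>k. real k * (m ^ k / fact k * exp (- m))) sums (m :: real)"
proof -
  have "(\<lambda>k. m * exp (- m) * (m ^ k /\<^sub>R fact k)) sums (m * exp (- m) * exp m)"
    by (rule sums_mult[OF exp_converges])
  moreover have "m * exp (- m) * (m ^ k /\<^sub>R fact k) = real (Suc k) * (m ^ Suc k / fact (Suc k) * exp (- m))" for k
    by (simp add: field_simps del: of_nat_Suc)
  ultimately have "(\<lambda>k. real (Suc k) * (m ^ Suc k / fact (Suc k) * exp (- m))) sums (m * exp (- m) * exp m)"
    by (simp only:)
  also have "m * exp (- m) * exp m = m" by (simp flip: exp_add)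
  finally show ?thesis by (subst (asm) sums_Suc_iff) simp
qed

lemma (in prob_space) poisson_has_bochner_integral:
  fixes X :: "'a \<Rightarrow> nat"
  assumes [measurable]: "X \<in> measurable M (count_space UNIV)"
    and poisson: "\<And>k. prob {\<omega>\<in>space M. X \<omega> = k} = m ^ k / fact k * exp (- m)"
    and "m \<ge> 0"
  shows "has_bochner_integral M (\<lambda>\<omega>. real (X \<omega>)) m"
proof (rule has_bochner_integral_nn_integral)
  have "(\<integral>\<^sup>+\<omega>. ennreal (real (X \<omega>)) \<partial>M)
    = (\<integral>\<^sup>+\<omega>. (\<Sum>k. ennreal (real k) * indicator {\<omega>\<in>space M. X \<omega> = k} \<omega>) \<partial>M)"
  proof (rule nn_integral_cong)
    fix \<omega> assume "\<omega> \<in> space M"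
    then have "(\<Sum>k. ennreal (real k) * indicator {\<omega>\<in>space M. X \<omega> = k} \<omega>)
        = (\<Sum>k\<in>{X \<omega>}. ennreal (real k) * indicator {\<omega>\<in>space M. X \<omega> = k} \<omega>)"
      by (intro suminf_finite) auto
    then show "ennreal (real (X \<omega>)) = (\<Sum>k. ennreal (real k) * indicator {\<omega>\<in>space M. X \<omega> = k} \<omega>)"
      using \<open>\<omega> \<in> space M\<close> by simp
  qed
  also have "\<dots> = (\<Sum>k. \<integral>\<^sup>+\<omega>. ennreal (real k) * indicator {\<omega>\<in>space M. X \<omega> = k} \<omega> \<partial>M)"
    by (rule nn_integral_suminf) measurable
  also have "\<dots> = (\<Sum>k. ennreal (real k * (m ^ k / fact k * exp (- m))))"
    using \<open>m \<ge> 0\<close>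
    by (intro suminf_cong, subst nn_integral_cmult_indicator)
       (auto simp: emeasure_eq_measure poisson simp flip: ennreal_mult')
  also have "\<dots> = ennreal m"
    using \<open>m \<ge> 0\<close> by (intro suminf_ennreal_eq poisson_weights_sums) auto
  finally show "(\<integral>\<^sup>+\<omega>. ennreal (real (X \<omega>)) \<partial>M) = ennreal m" .
qed (use assms in auto)

text \<open>Independence gives the product formula for finitely many indices only; continuity from
  above along \<open>I \<inter> {..<m}\<close> extends it to an infinite \<open>I\<close>. Extending
  \<open>L\<close> by 0 outside \<open>I\<close> lets one series serve finite and infinite index
  sets.\<close>

lemma (in prob_space) prob_all_zero_indep:
  fixes X :: "nat \<Rightarrow> 'a \<Rightarrow> nat" and L :: "nat \<Rightarrow> real"
  assumes X: "indep_vars (\<lambda>_. count_space UNIV) X I"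
    and void: "\<And>i. i \<in> I \<Longrightarrow> prob {\<omega>\<in>space M. X i \<omega> = 0} = exp (- L i)"
    and summ: "summable (\<lambda>i. if i \<in> I then L i else 0)"
  shows "prob {\<omega>\<in>space M. \<forall>i\<in>I. X i \<omega> = 0} = exp (- (\<Sum>i. if i \<in> I then L i else 0))"
proof -
  let ?L = "\<lambda>i. if i \<in> I then L i else 0"
  define A where "A = (\<lambda>m. {\<omega>\<in>space M. \<forall>i\<in>I \<inter> {..<m}. X i \<omega> = 0})"
  have Xm: "X i \<in> measurable M (count_space UNIV)" if "i \<in> I" for i
    using X that by (auto simp: indep_vars_def)
  have Am: "A m \<in> sets M" for m
  proof -
    have "{\<omega>\<in>space M. X i \<omega> = 0} \<in> sets M" if "i \<in> I" for i
      using Xm[OF that] by measurable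
    then show ?thesis
      unfolding A_def by (intro sets.sets_Collect_finite_All) auto
  qed
  have pA: "prob (A m) = exp (- (\<Sum>i<m. ?L i))" for m
  \<comment> \<open>The empty case is separate: the intersection over no indices is
    \<open>UNIV\<close> rather than \<open>space M\<close>.\<close>
  proof (cases "I \<inter> {..<m} = {}")
    case True
    then have "A m = space M" by (auto simp: A_def)
    moreover have "(\<Sum>i<m. ?L i) = 0" using True by (intro sum.neutral) auto
    ultimately show ?thesis by (simp add: prob_space)
  next
    case False
    have "indep_vars (\<lambda>_. count_space UNIV) X (I \<inter> {..<m})"
      by (rule indep_vars_subset[OF X]) auto
    from indep_varsD_finite[OF this False, of "\<lambda>_. {0}"]
    have "prob (\<Inter>i\<in>I \<inter> {..<m}. X i -` {0} \<inter> space M) = (\<Prod>i\<in>I \<inter> {..<m}. prob (X i -` {0} \<inter> space M))"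
      by simp
    moreover have "(\<Inter>i\<in>I \<inter> {..<m}. X i -` {0} \<inter> space M) = A m"
      using False by (auto simp: A_def)
    moreover have "prob (X i -` {0} \<inter> space M) = exp (- ?L i)" if "i \<in> I \<inter> {..<m}" for i
    proof -
      have "X i -` {0} \<inter> space M = {\<omega>\<in>space M. X i \<omega> = 0}" by auto
      then show ?thesis using void[of i] that by simp
    qed
    ultimately have "prob (A m) = (\<Prod>i\<in>I \<inter> {..<m}. exp (- ?L i))"
      by (metis (no_types, lifting) prod.cong)
    also have "\<dots> = exp (- (\<Sum>i\<in>I \<inter> {..<m}. ?L i))"
      by (simp add: exp_sum flip: sum_negf)
    also have "(\<Sum>i\<in>I \<inter> {..<m}. ?L i) = (\<Sum>i<m. ?L i)"
      by (intro sum.mono_neutral_left) auto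
    finally show ?thesis .
  qed
  have "(\<lambda>m. prob (A m)) \<longlonglongrightarrow> prob (\<Inter>m. A m)"
    using Am by (intro finite_Lim_measure_decseq) (auto simp: A_def decseq_def)
  moreover have "(\<Inter>m. A m) = {\<omega>\<in>space M. \<forall>i\<in>I. X i \<omega> = 0}"
    by (auto simp: A_def)
  moreover have "(\<lambda>m. prob (A m)) \<longlonglongrightarrow> exp (- (\<Sum>i. ?L i))"
    unfolding pA using summable_LIMSEQ[OF summ] by (intro tendsto_intros)
  ultimately show ?thesis by (metis LIMSEQ_unique)
qed

lemma prod_upto_exp:
  assumes "summable (\<lambda>N. if enat N \<le> Nmax then L N else 0)"
  shows "prod_upto Nmax (\<lambda>N. exp (- L N)) = exp (- (\<Sum>N. if enat N \<le> Nmax then L N else 0))"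
proof (cases Nmax)
  case (enat m)
  have "(\<Sum>N. if N \<le> m then L N else 0) = (\<Sum>N\<le>m. if N \<le> m then L N else 0)"
    by (rule suminf_finite) auto
  then show ?thesis
    by (simp add: enat prod_upto_def exp_sum sum_negf[symmetric] cong: prod.cong)
next
  case infinity
  then show ?thesis
    using assms prodinf_exp[of "\<lambda>N. - L N"] by (simp add: prod_upto_def suminf_minus summable_minus_iff)
qed

text \<open>Losses are never negative, so the lower end of \<open>{0..<\<alpha>}\<close> is no
  restriction, and the support condition supplies the membership in the disc that
  \<open>loss_region\<close> demands.\<close>

lemma count_in_loss_process:
  assumes "\<kappa> > 0" "K > 0" "set_mset (\<Psi> \<omega>) \<subseteq> cball 0 R"
  shows "count_in {0..<\<alpha>} (loss_process \<kappa> \<beta> K N \<Psi> \<omega>) = count_in (loss_region \<kappa> \<beta> K R N \<alpha>) (\<Psi> \<omega>)"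
proof -
  have "filter_mset (\<lambda>z. path_loss \<kappa> \<beta> K N (cmod z) \<in> {0..<\<alpha>}) (\<Psi> \<omega>)
      = filter_mset (\<lambda>z. z \<in> loss_region \<kappa> \<beta> K R N \<alpha>) (\<Psi> \<omega>)"
    using assms path_loss_nonneg[OF assms(1,2)]
    by (intro filter_mset_cong) (auto simp: loss_region_def)
  then show ?thesis
    by (simp add: count_in_def loss_process_def filter_mset_image_mset comp_def)
qed

lemma min_loss_less_iff:
  "min_loss \<kappa> \<beta> K Nmax \<Psi> \<omega> < a \<longleftrightarrow>
    (\<exists>N. enat N \<le> Nmax \<and> (\<exists>z\<in>#\<Psi> N \<omega>. ereal (path_loss \<kappa> \<beta> K N (cmod z)) < a))"
  by (simp add: min_loss_def INF_less_iff)

text \<open>An infimum is strictly below \<open>a\<close> exactly when some element is, so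
  \<open>min_loss < a\<close> is a countable union of events that a count is nonzero. With a weak
  inequality this would fail, as the infimum need not be attained.\<close>

lemma min_loss_measurable:
  assumes "\<And>N. enat N \<le> Nmax \<Longrightarrow> \<Psi> N \<in> measurable M (configurations (ph_intensity lPH lw R N))"
  shows "min_loss \<kappa> \<beta> K Nmax \<Psi> \<in> borel_measurable M"
proof (rule borel_measurableI_less)
  fix a :: ereal
  \<comment> \<open>An analogue of \<open>loss_region\<close> whose threshold may be any extended
    real.\<close>
  define B where "B = (\<lambda>N. {z \<in> cball (0::complex) R. ereal (path_loss \<kappa> \<beta> K N (cmod z)) < a})"
  have B: "B N \<in> sets (ph_intensity lPH lw R N)" for N
  proof -
    have "Measurable.pred borel (\<lambda>z::complex. cmod z \<le> R \<and> ereal (path_loss \<kappa> \<beta> K N (cmod z)) < a)"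
      unfolding path_loss_def by measurable
    then show ?thesis
      by (auto simp: sets_ph_intensity B_def pred_def cball_def)
  qed
  have "{\<omega>\<in>space M. min_loss \<kappa> \<beta> K Nmax \<Psi> \<omega> < a}
    = (\<Union>N\<in>{N. enat N \<le> Nmax}. {\<omega>\<in>space M. count_in (B N) (\<Psi> N \<omega>) \<noteq> 0})"
  proof -
    have "set_mset (\<Psi> N \<omega>) \<subseteq> cball 0 R" if "enat N \<le> Nmax" "\<omega> \<in> space M" for N \<omega>
      using measurable_space[OF assms[OF that(1)] that(2)] by (simp add: space_configurations)
    then show ?thesis
      unfolding min_loss_less_iff count_in_eq_0_iff B_def by (auto simp: subset_iff; blast)
  qed
  also have "\<dots> \<in> sets M"
  proof (intro sets.countable_UN'')
    fix N assume "N \<in> {N. enat N \<le> Nmax}"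
    then have "(\<lambda>\<omega>. count_in (B N) (\<Psi> N \<omega>)) \<in> measurable M (count_space UNIV)"
      using measurable_compose[OF assms count_in_measurable[OF B]] by simp
    then show "{\<omega>\<in>space M. count_in (B N) (\<Psi> N \<omega>) \<noteq> 0} \<in> sets M" by measurable
  qed auto
  finally show "{\<omega>\<in>space M. min_loss \<kappa> \<beta> K Nmax \<Psi> \<omega> < a} \<in> sets M" .
qed

section \<open>The distribution function of the smallest loss\<close>

theorem proposition1:
  fixes M :: "'w measure"
    and lPH lw \<kappa> \<beta> K R :: real
    and Nmax :: enat
    and \<Psi> :: "nat \<Rightarrow> 'w \<Rightarrow> complex multiset"
  assumes "prob_space M"
    and "lPH > 0" and "lw > 0" and "\<beta> > 0" and "\<kappa> > 0" and "R > 0"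
    and "0 < K" and "K < 1"
    and poisson: "\<And>N. enat N \<le> Nmax \<Longrightarrow> poisson_process M (ph_intensity lPH lw R N) (\<Psi> N)"
    and indep: "prob_space.indep_vars M (\<lambda>N. configurations (ph_intensity lPH lw R N)) \<Psi>
                  {N. enat N \<le> Nmax}"
  shows "min_loss \<kappa> \<beta> K Nmax \<Psi> \<in> borel_measurable M \<and>
    (\<forall>\<alpha>>0.
      (\<forall>N. enat N \<le> Nmax \<longrightarrow>
         summable (\<lambda>j. Lambda_term lw \<kappa> \<beta> K R N \<alpha> (j + N)) \<and>
         has_bochner_integral M
           (\<lambda>\<omega>. real (count_in {0..<\<alpha>} (loss_process \<kappa> \<beta> K N (\<Psi> N) \<omega>)))
           (Lambda lPH lw \<kappa> \<beta> K R N \<alpha>)) \<and>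
      (Nmax = \<infinity> \<longrightarrow> convergent_prod (\<lambda>N. exp (- Lambda lPH lw \<kappa> \<beta> K R N \<alpha>))) \<and>
      measure M {\<omega>\<in>space M. min_loss \<kappa> \<beta> K Nmax \<Psi> \<omega> \<le> ereal \<alpha>}
        = 1 - prod_upto Nmax (\<lambda>N. exp (- Lambda lPH lw \<kappa> \<beta> K R N \<alpha>)))"
proof -
  interpret prob_space M by fact
  let ?\<mu> = "ph_intensity lPH lw R"
  let ?\<Lambda> = "Lambda lPH lw \<kappa> \<beta> K R"
  let ?I = "{N. enat N \<le> Nmax}"
  define X where "X = (\<lambda>\<alpha> N \<omega>. count_in (loss_region \<kappa> \<beta> K R N \<alpha>) (\<Psi> N \<omega>))"
  define S where "S = (\<lambda>\<alpha>. \<Sum>N. if N \<in> ?I then ?\<Lambda> N \<alpha> else 0)"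
  have \<Psi>m: "\<Psi> N \<in> measurable M (configurations (?\<mu> N))" if "enat N \<le> Nmax" for N
    using poisson[OF that] by (simp add: poisson_process_def)
  have supp: "set_mset (\<Psi> N \<omega>) \<subseteq> cball 0 R" if "enat N \<le> Nmax" "\<omega> \<in> space M" for N \<omega>
    using measurable_space[OF \<Psi>m[OF that(1)] that(2)] by (simp add: space_configurations)
  have region: "loss_region \<kappa> \<beta> K R N \<alpha> \<in> sets (?\<mu> N)" for N \<alpha>
    by (simp add: sets_ph_intensity loss_region_subset_cball)
  have Xm: "X \<alpha> N \<in> measurable M (count_space UNIV)" if "enat N \<le> Nmax" for \<alpha> N
    unfolding X_def by (rule measurable_compose[OF \<Psi>m[OF that] count_in_measurable[OF region]])
  \<comment> \<open>The value \<open>k = 0\<close> gives the void probabilities, the whole law gives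
    the expected counts.\<close>
  have Xprob: "prob {\<omega>\<in>space M. X \<alpha> N \<omega> = k} = ?\<Lambda> N \<alpha> ^ k / fact k * exp (- ?\<Lambda> N \<alpha>)"
    if "enat N \<le> Nmax" "\<alpha> > 0" for \<alpha> N k
    using poisson[OF that(1)] region[of N \<alpha>] that(2) assms
    by (simp add: poisson_process_def X_def Lambda_eq_measure)
  have meas: "min_loss \<kappa> \<beta> K Nmax \<Psi> \<in> borel_measurable M"
    using \<Psi>m by (rule min_loss_measurable)
  \<comment> \<open>Area grows like the squared radius and the loss radius like
    \<open>\<alpha> powr (1 / \<beta>)\<close>, whence the exponent \<open>2 / \<beta>\<close>. As
    \<open>K < 1\<close>, the ratio \<open>q\<close> is below 1, and \<open>C\<close> collects the
    constants so that the area bound reads \<open>\<alpha> powr p * (C * q ^ N)\<close>.\<close>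
  define p q where "p = 2 / \<beta>" and "q = K powr p"
  define C where "C = lPH * pi * \<kappa> powr (- p)"
  have q: "0 < q" "q < 1"
    using assms powr_less_mono2[of p K 1] by (auto simp: q_def p_def)
  have qsum: "summable (\<lambda>N. C * q ^ N)"
    using q by (intro summable_mult summable_geometric) auto
  have C0: "C > 0" using assms by (simp add: C_def)
  have rad: "lPH * (pi * (loss_radius \<kappa> \<beta> K N \<alpha>)\<^sup>2) = \<alpha> powr p * (C * q ^ N)" if "\<alpha> > 0" for N \<alpha>
    using loss_radius_squared[of \<kappa> K \<alpha> \<beta> N] assms that by (simp add: p_def q_def C_def mult_ac)
  have \<Lambda>0: "?\<Lambda> N \<alpha> \<ge> 0" if "\<alpha> > 0" for N \<alpha>
    using assms that by (intro Lambda_nonneg)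
  have \<Lambda>sum: "summable (\<lambda>N. ?\<Lambda> N \<alpha>)" if "\<alpha> > 0" for \<alpha>
  proof (rule summable_comparison_test')
    show "summable (\<lambda>N. \<alpha> powr p * (C * q ^ N))" using qsum by (rule summable_mult)
    show "norm (?\<Lambda> N \<alpha>) \<le> \<alpha> powr p * (C * q ^ N)" for N
      using Lambda_le[of lw lPH \<beta> \<kappa> K R \<alpha> N] \<Lambda>0[OF that] assms that by (simp add: rad)
  qed
  have Ssum: "summable (\<lambda>N. if N \<in> ?I then ?\<Lambda> N \<alpha> else 0)" if "\<alpha> > 0" for \<alpha>
    using \<Lambda>0[OF that] by (intro summable_comparison_test'[OF \<Lambda>sum[OF that]]) auto
  have prob_less: "prob {\<omega>\<in>space M. min_loss \<kappa> \<beta> K Nmax \<Psi> \<omega> < ereal \<alpha>} = 1 - exp (- S \<alpha>)"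
    if "\<alpha> > 0" for \<alpha>
  proof -
    \<comment> \<open>Independence of the processes passes to their counts, which are measurable
      functions of the configurations.\<close>
    have "indep_vars (\<lambda>_. count_space UNIV) (X \<alpha>) ?I"
      unfolding X_def by (rule indep_vars_compose2[OF indep]) (rule count_in_measurable[OF region])
    then have "prob {\<omega>\<in>space M. \<forall>N\<in>?I. X \<alpha> N \<omega> = 0} = exp (- S \<alpha>)"
      unfolding S_def using Xprob[OF _ that, of _ 0] by (intro prob_all_zero_indep Ssum[OF that]) auto
    moreover have "{\<omega>\<in>space M. \<forall>N\<in>?I. X \<alpha> N \<omega> = 0}
        = space M - {\<omega>\<in>space M. min_loss \<kappa> \<beta> K Nmax \<Psi> \<omega> < ereal \<alpha>}"
      using supp unfolding min_loss_less_iff X_def count_in_eq_0_iff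
      by (auto simp: loss_region_def subset_iff; blast)
    moreover have "{\<omega>\<in>space M. min_loss \<kappa> \<beta> K Nmax \<Psi> \<omega> < ereal \<alpha>} \<in> sets M"
      using meas by measurable
    ultimately show ?thesis by (simp add: prob_compl)
  qed
  \<comment> \<open>The increment bounds are summed over all \<open>N\<close>; the factor in
    \<alpha> and \<alpha>' comes out of the geometric series, giving right-continuity of the total
    intensity.\<close>
  have S_le: "S \<alpha>' \<le> S \<alpha> + (\<alpha>' powr p - \<alpha> powr p) * (\<Sum>N. C * q ^ N)" if "\<alpha> > 0" "\<alpha> \<le> \<alpha>'" for \<alpha> \<alpha>'
  proof -
    have \<alpha>': "\<alpha>' > 0" using that by simp
    have mono: "\<alpha> powr p \<le> \<alpha>' powr p" using that assms by (intro powr_mono2) (auto simp: p_def)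
    have "S \<alpha>' \<le> (\<Sum>N. (if N \<in> ?I then ?\<Lambda> N \<alpha> else 0) + (\<alpha>' powr p - \<alpha> powr p) * (C * q ^ N))"
      unfolding S_def
    proof (rule suminf_le[OF _ Ssum[OF \<alpha>'] summable_add[OF Ssum[OF that(1)] summable_mult[OF qsum]]])
      fix N
      have "?\<Lambda> N \<alpha>' \<le> ?\<Lambda> N \<alpha> + (\<alpha>' powr p - \<alpha> powr p) * (C * q ^ N)"
        using Lambda_increment_le[of lw lPH \<beta> \<kappa> K R \<alpha> \<alpha>' N] assms that rad[OF that(1), of N] rad[OF \<alpha>', of N]
        by (simp add: right_diff_distrib left_diff_distrib)
      moreover have "0 \<le> (\<alpha>' powr p - \<alpha> powr p) * (C * q ^ N)"
        using mono C0 q by simp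
      ultimately show "(if N \<in> ?I then ?\<Lambda> N \<alpha>' else 0)
          \<le> (if N \<in> ?I then ?\<Lambda> N \<alpha> else 0) + (\<alpha>' powr p - \<alpha> powr p) * (C * q ^ N)" by simp
    qed
    also have "\<dots> = S \<alpha> + (\<Sum>N. (\<alpha>' powr p - \<alpha> powr p) * (C * q ^ N))"
      unfolding S_def by (rule suminf_add[symmetric, OF Ssum[OF that(1)] summable_mult[OF qsum]])
    also have "(\<Sum>N. (\<alpha>' powr p - \<alpha> powr p) * (C * q ^ N)) = (\<alpha>' powr p - \<alpha> powr p) * (\<Sum>N. C * q ^ N)"
      by (rule suminf_mult[OF qsum])
    finally show ?thesis .
  qed
  have prob_le: "prob {\<omega>\<in>space M. min_loss \<kappa> \<beta> K Nmax \<Psi> \<omega> \<le> ereal \<alpha>} = 1 - exp (- S \<alpha>)"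
    if "\<alpha> > 0" for \<alpha>
  proof (rule antisym)
    let ?F = "prob {\<omega>\<in>space M. min_loss \<kappa> \<beta> K Nmax \<Psi> \<omega> \<le> ereal \<alpha>}"
    \<comment> \<open>By \<open>S_le\<close>, \<open>G a\<close> bounds the probability of
      \<open>min_loss < a\<close> from above for every \<open>a > \<alpha>\<close>. Being continuous
      at \<alpha>, it tends to the claimed value as \<open>a\<close> decreases to \<alpha>.\<close>
    define G where "G = (\<lambda>a. 1 - exp (- (S \<alpha> + (a powr p - \<alpha> powr p) * (\<Sum>N. C * q ^ N))))"
    have "(G \<longlongrightarrow> 1 - exp (- (S \<alpha> + (\<alpha> powr p - \<alpha> powr p) * (\<Sum>N. C * q ^ N)))) (at_right \<alpha>)"
      unfolding G_def using that by (intro tendsto_intros) auto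
    then have lim: "(G \<longlongrightarrow> 1 - exp (- S \<alpha>)) (at_right \<alpha>)" by simp
    have "?F \<le> G a" if "a > \<alpha>" for a
    proof -
      have "?F \<le> prob {\<omega>\<in>space M. min_loss \<kappa> \<beta> K Nmax \<Psi> \<omega> < ereal a}"
      proof (rule finite_measure_mono)
        show "{\<omega>\<in>space M. min_loss \<kappa> \<beta> K Nmax \<Psi> \<omega> \<le> ereal \<alpha>}
          \<subseteq> {\<omega>\<in>space M. min_loss \<kappa> \<beta> K Nmax \<Psi> \<omega> < ereal a}"
          using that by (auto intro: le_less_trans)
        show "{\<omega>\<in>space M. min_loss \<kappa> \<beta> K Nmax \<Psi> \<omega> < ereal a} \<in> sets M"
          using meas by measurable
      qed
      also have "\<dots> \<le> G a"
        using prob_less[of a] S_le[of \<alpha> a] that \<open>\<alpha> > 0\<close> by (simp add: G_def)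
      finally show ?thesis .
    qed
    then have "eventually (\<lambda>a. ?F \<le> G a) (at_right \<alpha>)"
      by (auto simp: eventually_at_filter)
    then show "?F \<le> 1 - exp (- S \<alpha>)"
      by (intro tendsto_lowerbound[OF lim]) auto
    have "prob {\<omega>\<in>space M. min_loss \<kappa> \<beta> K Nmax \<Psi> \<omega> < ereal \<alpha>} \<le> ?F"
    proof (rule finite_measure_mono)
      show "{\<omega>\<in>space M. min_loss \<kappa> \<beta> K Nmax \<Psi> \<omega> \<le> ereal \<alpha>} \<in> sets M"
        using meas by measurable
    qed auto
    then show "1 - exp (- S \<alpha>) \<le> ?F" using prob_less[OF that] by simp
  qed
  show ?thesis
  proof (intro conjI allI impI)
    show "min_loss \<kappa> \<beta> K Nmax \<Psi> \<in> borel_measurable M" by (rule meas)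
  next
    fix \<alpha> :: real and N assume "\<alpha> > 0" "enat N \<le> Nmax"
    show "summable (\<lambda>j. Lambda_term lw \<kappa> \<beta> K R N \<alpha> (j + N))"
      using assms \<open>\<alpha> > 0\<close> by (intro summable_Lambda_term)
    have "has_bochner_integral M (\<lambda>\<omega>. real (X \<alpha> N \<omega>)) (?\<Lambda> N \<alpha>)"
      by (rule poisson_has_bochner_integral[OF Xm Xprob \<Lambda>0]) fact+
    \<comment> \<open>The counts agree only on \<open>space M\<close>, where the configurations are
      known to lie in the disc; this suffices for the integral.\<close>
    moreover have "real (count_in {0..<\<alpha>} (loss_process \<kappa> \<beta> K N (\<Psi> N) \<omega>)) = real (X \<alpha> N \<omega>)"
      if "\<omega> \<in> space M" for \<omega>
      using count_in_loss_process[of \<kappa> K "\<Psi> N" \<omega> R \<alpha> \<beta> N] supp[OF \<open>enat N \<le> Nmax\<close> that] assms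
      by (simp add: X_def)
    ultimately show "has_bochner_integral M
        (\<lambda>\<omega>. real (count_in {0..<\<alpha>} (loss_process \<kappa> \<beta> K N (\<Psi> N) \<omega>))) (?\<Lambda> N \<alpha>)"
      by (subst has_bochner_integral_cong[OF refl _ refl])
  next
    fix \<alpha> :: real assume "\<alpha> > 0"
    show "convergent_prod (\<lambda>N. exp (- ?\<Lambda> N \<alpha>))"
      using \<Lambda>sum[OF \<open>\<alpha> > 0\<close>] by (intro convergent_prod_exp) (simp add: summable_minus_iff)
    show "prob {\<omega>\<in>space M. min_loss \<kappa> \<beta> K Nmax \<Psi> \<omega> \<le> ereal \<alpha>} = 1 - prod_upto Nmax (\<lambda>N. exp (- ?\<Lambda> N \<alpha>))"
      using prob_le[OF \<open>\<alpha> > 0\<close>] prod_upto_exp[of Nmax "\<lambda>N. ?\<Lambda> N \<alpha>"] Ssum[OF \<open>\<alpha> > 0\<close>]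
      by (simp add: S_def)
  qed
qed

end
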